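(* There is an absolute constant $C>0$ with the following property. Let $g,h:\mathbb{R}^d\to\mathbb{R}$ be convex with $h$ $L_h$-smooth ($L_h>0$), let $\gamma>0$, let $f_\gamma=g_\gamma-h$ with $g_\gamma$ the Moreau envelope of $g$, assume $f_\gamma^\star=\inf f_\gamma>-\infty$, and put $L_\gamma=L_h+\frac1\gamma$. Assume the stochastic subgradients of $g$ are unbiased with $\mathbb{E}\|\partial g(x,\xi)\|^2\le M^2$ for all $x$, and the stochastic gradients of $h$ are unbiased with $\mathbb{E}\|\nabla h(x,\xi)-\nabla h(x)\|^2\le\sigma^2$ for all $x$. Run the single-loop algorithm with momentum (defined in the context) for $T\ge 1$ iterations with constant parameters $\alpha_t=\alpha=2\sqrt2\,L_h\eta^0$, $\eta^1=\sqrt{32}\,\eta^0$ and $$\eta^0=\min\left\{\frac{1}{L_\gamma},\frac{1}{L_h},\sqrt{\frac{\phi_0}{T(L_h\sigma^2+M^2/\gamma)}}\right\},$$ where $$\phi_0:=\mathbb{E}[f_\gamma(x_0)-f_\gamma^\star]+\frac{2\eta^0}{\gamma\eta^1}\mathbb{E}\|x^g_1-\operatorname{prox}_{\gamma g}(x_0)\|^2+\frac{\eta^0}{\alpha}\mathbb{E}\|m^h_0-\nabla h(x_0)\|^2 .$$ Then $$\frac1T\sum_{t=0}^{T-1}\mathbb{E}\|\nabla f_\gamma(x_t)\|^2\le C\left(\sqrt{\frac{(L_h\sigma^2+M^2/\gamma)\,\phi_0}{T}}+\frac{L_\gamma\phi_0}{T}\right).$$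
   Context: Notation: $\operatorname{prox}_{\gamma g}(x)=\arg\min_y\{\gamma g(y)+\frac12\|y-x\|^2\}$; the Moreau envelope is $g_\gamma(x)=\min_y\{g(y)+\frac{1}{2\gamma}\|y-x\|^2\}$; "$L_h$-smooth" means differentiable with $L_h$-Lipschitz gradient. Unbiased means $\mathbb{E}[\partial g(x,\xi)]\in\partial g(x)$, respectively $\mathbb{E}[\nabla h(x,\xi)]=\nabla h(x)$, for all $x\in\mathbb{R}^d$. Single-loop algorithm with momentum (momentum weights $\alpha_t\in(0,1]$): start from $x_0,x^g_0\in\mathbb{R}^d$. For $t=0,1,\dots$ draw fresh samples $\xi^h_t,\xi^g_t$, independent of the past; set $m^h_0=\nabla h(x_0,\xi^h_0)$ and $m^h_t=(1-\alpha_{t-1})m^h_{t-1}+\alpha_{t-1}\nabla h(x_t,\xi^h_t)$ for $t\ge1$; then $$x^g_{t+1}=x^g_t-\eta^1\Big(\partial g(x^g_t,\xi^g_t)+\frac{x^g_t-x_t}{\gamma}\Big),\qquad x_{t+1}=x_t-\eta^0\Big(\frac{x_t-x^g_{t+1}}{\gamma}-m^h_t\Big).$$ All expectations appearing are assumed finite. *)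

theory Defs
  imports "HOL-Probability.Probability"
begin

definition grad :: "('a::real_inner \<Rightarrow> real) \<Rightarrow> 'a \<Rightarrow> 'a" where
  "grad f x = (THE D. GDERIV f x :> D)"

definition smooth_fun :: "real \<Rightarrow> ('a::real_inner \<Rightarrow> real) \<Rightarrow> bool" where
  "smooth_fun L f \<longleftrightarrow> (\<forall>x. f differentiable (at x)) \<and> L-lipschitz_on UNIV (grad f)"

definition subdifferential :: "('a::real_inner \<Rightarrow> real) \<Rightarrow> 'a \<Rightarrow> 'a set" where
  "subdifferential g x = {v. \<forall>y. g y \<ge> g x + v \<bullet> (y - x)}"

definition prox :: "real \<Rightarrow> ('a::real_inner \<Rightarrow> real) \<Rightarrow> 'a \<Rightarrow> 'a" where
  "prox \<gamma> g x = (ARG_MIN (\<lambda>y. \<gamma> * g y + 1/2 * (norm (y - x))\<^sup>2) y. True)"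

(* For convex g on a Euclidean space and gamma > 0 the infimum is attained (at prox gamma g x),
   so it is the minimum. *)
definition moreau_envelope :: "real \<Rightarrow> ('a::real_inner \<Rightarrow> real) \<Rightarrow> 'a \<Rightarrow> real" where
  "moreau_envelope \<gamma> g x = (INF y. g y + 1 / (2 * \<gamma>) * (norm (y - x))\<^sup>2)"

(* A stochastic oracle is a function of the query point and of a sample whose distribution is
   the probability measure D; it is jointly measurable in both arguments. *)

definition unbiased_subgradient_oracle ::
  "('a::euclidean_space \<Rightarrow> real) \<Rightarrow> 's measure \<Rightarrow> ('a \<Rightarrow> 's \<Rightarrow> 'a) \<Rightarrow> real \<Rightarrow> bool" where
  "unbiased_subgradient_oracle g D dg M \<longleftrightarrow>
     prob_space D \<and> (\<lambda>(x, s). dg x s) \<in> borel_measurable (borel \<Otimes>\<^sub>M D) \<and>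
     (\<forall>x. integrable D (dg x) \<and> (\<integral>s. dg x s \<partial>D) \<in> subdifferential g x \<and>
          integrable D (\<lambda>s. (norm (dg x s))\<^sup>2) \<and> (\<integral>s. (norm (dg x s))\<^sup>2 \<partial>D) \<le> M\<^sup>2)"

definition unbiased_gradient_oracle ::
  "('a::euclidean_space \<Rightarrow> real) \<Rightarrow> 's measure \<Rightarrow> ('a \<Rightarrow> 's \<Rightarrow> 'a) \<Rightarrow> real \<Rightarrow> bool" where
  "unbiased_gradient_oracle h D dh \<sigma> \<longleftrightarrow>
     prob_space D \<and> (\<lambda>(x, s). dh x s) \<in> borel_measurable (borel \<Otimes>\<^sub>M D) \<and>
     (\<forall>x. integrable D (dh x) \<and> (\<integral>s. dh x s \<partial>D) = grad h x \<and>
          integrable D (\<lambda>s. (norm (dh x s - grad h x))\<^sup>2) \<and>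
          (\<integral>s. (norm (dh x s - grad h x))\<^sup>2 \<partial>D) \<le> \<sigma>\<^sup>2)"

(* The past at time t consists of the (possibly random) starting points and all samples drawn
   before time t.  The two samples of the same iteration are allowed to be dependent. *)
definition fresh_samples ::
  "'w measure \<Rightarrow> ('w \<Rightarrow> 'a::euclidean_space) \<Rightarrow> ('w \<Rightarrow> 'a) \<Rightarrow>
   's measure \<Rightarrow> (nat \<Rightarrow> 'w \<Rightarrow> 's) \<Rightarrow> 'u measure \<Rightarrow> (nat \<Rightarrow> 'w \<Rightarrow> 'u) \<Rightarrow> bool" where
  "fresh_samples P x0 xg0 DH \<xi>h DG \<xi>g \<longleftrightarrow>
     x0 \<in> borel_measurable P \<and> xg0 \<in> borel_measurable P \<and>
     (\<forall>t. \<xi>h t \<in> measurable P DH \<and> distr P DH (\<xi>h t) = DH \<and>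
          \<xi>g t \<in> measurable P DG \<and> distr P DG (\<xi>g t) = DG \<and>
          prob_space.indep_set P
            (sets (vimage_algebra (space P)
               (\<lambda>\<omega>. (x0 \<omega>, xg0 \<omega>, \<lambda>s\<in>{..<t}. (\<xi>h s \<omega>, \<xi>g s \<omega>)))
               (borel \<Otimes>\<^sub>M borel \<Otimes>\<^sub>M (\<Pi>\<^sub>M s\<in>{..<t}. DH \<Otimes>\<^sub>M DG))))
            (sets (vimage_algebra (space P) (\<lambda>\<omega>. (\<xi>h t \<omega>, \<xi>g t \<omega>)) (DH \<Otimes>\<^sub>M DG))))"

(* One trajectory of the algorithm: dg, dh are the stochastic oracles, \<xi>g, \<xi>h the realised
   samples, and x, xg, m the sequences x_t, x^g_t, m^h_t. *)
definition single_loop_momentum ::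
  "real \<Rightarrow> real \<Rightarrow> real \<Rightarrow> (nat \<Rightarrow> real) \<Rightarrow>
   ('a::real_vector \<Rightarrow> 'u \<Rightarrow> 'a) \<Rightarrow> ('a \<Rightarrow> 's \<Rightarrow> 'a) \<Rightarrow> (nat \<Rightarrow> 'u) \<Rightarrow> (nat \<Rightarrow> 's) \<Rightarrow>
   (nat \<Rightarrow> 'a) \<Rightarrow> (nat \<Rightarrow> 'a) \<Rightarrow> (nat \<Rightarrow> 'a) \<Rightarrow> bool" where
  "single_loop_momentum \<gamma> \<eta>0 \<eta>1 \<alpha> dg dh \<xi>g \<xi>h x xg m \<longleftrightarrow>
     (\<forall>t. 0 < \<alpha> t \<and> \<alpha> t \<le> 1) \<and>
     m 0 = dh (x 0) (\<xi>h 0) \<and>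
     (\<forall>t. m (Suc t) = (1 - \<alpha> t) *\<^sub>R m t + \<alpha> t *\<^sub>R dh (x (Suc t)) (\<xi>h (Suc t))) \<and>
     (\<forall>t. xg (Suc t) = xg t - \<eta>1 *\<^sub>R (dg (xg t) (\<xi>g t) + (xg t - x t) /\<^sub>R \<gamma>)) \<and>
     (\<forall>t. x (Suc t) = x t - \<eta>0 *\<^sub>R ((x t - xg (Suc t)) /\<^sub>R \<gamma> - m t))"

(* min {a, b, sqrt (p / n)} with the convention sqrt (p / 0) = infinity; division in HOL would
   instead give 0 and turn a noiseless run (n = 0) into one with step size 0. *)
definition capped_stepsize :: "real \<Rightarrow> real \<Rightarrow> real \<Rightarrow> real \<Rightarrow> real" where
  "capped_stepsize a b p n =
     (if n = 0 then min a b else min a (min b (sqrt (p / n))))"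

(* On the main theorem: type variables are quantified outside the whole formula, so a bare
   existential over C > 0 would let C depend on the type 'a of the space (hence on its dimension)
   and on the types of the sample spaces.  The additional numerical cap on C rules this out: it
   makes the constant absolute.  The value of the cap has no further significance. *)

end

theory Submission
  imports Defs
begin

text \<open>Because \<open>h \<le> g - inf f\<close> with \<open>g\<close> being \<open>\<bar>M\<bar>\<close>-Lipschitz, convexity forces
  \<open>\<parallel>\<nabla>h\<parallel> \<le> \<bar>M\<bar>\<close> and hence \<open>\<parallel>\<nabla>f\<parallel> \<le> 2\<bar>M\<bar>\<close> everywhere.  If \<open>\<eta>1 > \<gamma>\<close>, the recursion for the
  proximal error need not contract, but then the cap on \<open>\<eta>0\<close> makes \<open>M\<^sup>2\<close> at most of order
  \<open>\<phi>0 / (\<gamma> T)\<close> and the uniform gradient bound suffices.  If \<open>\<eta>1 \<le> \<gamma>\<close>, the function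
  \<open>f x - inf f + \<eta>0 / (\<gamma> \<eta>1) \<parallel>xg - prox x\<parallel>\<^sup>2 + \<eta>0 / \<alpha> \<parallel>m - \<nabla>h x\<parallel>\<^sup>2\<close> decreases in expectation by
  \<open>\<eta>0 / 2 \<parallel>\<nabla>f\<parallel>\<^sup>2\<close>, up to noise of order \<open>\<eta>0\<^sup>2 (L\<^sub>h \<sigma>\<^sup>2 + M\<^sup>2 / \<gamma>)\<close> per step; as \<open>h\<close> is convex, the
  descent inequality for \<open>f\<close> only sees the smoothness constant \<open>1 / \<gamma>\<close> of the envelope.\<close>

subsection \<open>Gradients and subgradients\<close>

lemma grad_eqI:
  assumes "GDERIV f x :> D"
  shows "grad f x = D"
  unfolding grad_def
proof (rule the_equality[where a = D])
  show "GDERIV f x :> D" by fact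
next
  fix E assume "GDERIV f x :> E"
  then have "(\<lambda>h. h \<bullet> E) = (\<lambda>h. h \<bullet> D)"
    using assms unfolding gderiv_def by (rule has_derivative_unique)
  then have "(E - D) \<bullet> (E - D) = 0"
    by (metis inner_diff_right diff_self)
  then show "E = D" by simp
qed

lemma differentiable_imp_GDERIV_grad:
  fixes f :: "'a::euclidean_space \<Rightarrow> real"
  assumes "f differentiable (at x)"
  shows "GDERIV f x :> grad f x"
proof -
  obtain F where F: "(f has_derivative F) (at x)"
    using assms unfolding differentiable_def by blast
  \<comment> \<open>The representing vector of the functional \<open>F\<close> is its adjoint
    applied to 1.\<close>
  have "F v = v \<bullet> adjoint F 1" for v
    using adjoint_works[OF has_derivative_linear[OF F], of v 1] by simp
  with F have "GDERIV f x :> adjoint F 1"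
    unfolding gderiv_def by (metis ext)
  then show ?thesis using grad_eqI by metis
qed

text \<open>Restricted to the line through \<open>x\<close> and \<open>y\<close>, the function is
  convex in one variable and lies above its tangent at 0.\<close>

lemma convex_GDERIV_in_subdifferential:
  fixes f :: "'a::real_inner \<Rightarrow> real"
  assumes cvx: "convex_on UNIV f" and D: "GDERIV f x :> D"
  shows "D \<in> subdifferential f x"
  unfolding subdifferential_def
proof (intro CollectI allI)
  fix y
  define q where "q = (\<lambda>t::real. f (x + t *\<^sub>R (y - x)))"
  have "convex_on UNIV q"
  proof (rule convex_onI)
    fix t a b :: real assume t: "0 < t" "t < 1"
    have "x + ((1 - t) * a + t * b) *\<^sub>R (y - x)
        = (1 - t) *\<^sub>R (x + a *\<^sub>R (y - x)) + t *\<^sub>R (x + b *\<^sub>R (y - x))"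
      by (simp add: algebra_simps)
    then show "q ((1 - t) *\<^sub>R a + t *\<^sub>R b) \<le> (1 - t) * q a + t * q b"
      using convex_onD[OF cvx, of t "x + a *\<^sub>R (y - x)" "x + b *\<^sub>R (y - x)"] t
      by (simp add: q_def)
  qed simp
  moreover have "(q has_real_derivative D \<bullet> (y - x)) (at 0)"
  proof -
    have "((\<lambda>t::real. x + t *\<^sub>R (y - x)) has_derivative (\<lambda>t. t *\<^sub>R (y - x))) (at 0)"
      by (auto intro!: derivative_eq_intros)
    moreover have "(f has_derivative (\<lambda>h. h \<bullet> D)) (at (x + 0 *\<^sub>R (y - x)))"
      using D by (simp add: gderiv_def)
    ultimately have "(q has_derivative (\<lambda>t. (t *\<^sub>R (y - x)) \<bullet> D)) (at 0)"
      unfolding q_def by (rule has_derivative_compose)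
    moreover have "(\<lambda>t. (t *\<^sub>R (y - x)) \<bullet> D) = (*) (D \<bullet> (y - x))"
      by (simp add: fun_eq_iff inner_commute)
    ultimately show ?thesis by (simp add: has_field_derivative_def)
  qed
  ultimately have "q 1 - q 0 \<ge> D \<bullet> (y - x) * (1 - 0)"
    by (intro convex_on_imp_above_tangent) auto
  then show "f y \<ge> f x + D \<bullet> (y - x)" by (simp add: q_def)
qed

text \<open>Testing the subgradient inequality at \<open>x + v\<close> gives |v|^2 \<le> N
  |v|.\<close>

lemma subdifferential_norm_le:
  assumes lip: "N-lipschitz_on UNIV f" and v: "v \<in> subdifferential f x"
  shows "norm v \<le> N"
proof -
  have "v \<bullet> v \<le> f (x + v) - f x"
    using v unfolding subdifferential_def by (force dest: spec[of _ "x + v"])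
  also have "\<dots> \<le> N * norm v"
    using lipschitz_onD[OF lip, of "x + v" x] by (simp add: dist_norm)
  finally have "norm v * norm v \<le> N * norm v" by (simp add: dot_square_norm power2_eq_square)
  then show ?thesis
    using lipschitz_on_nonneg[OF lip] by (cases "v = 0") auto
qed

lemma subdifferential_monotone:
  assumes "u \<in> subdifferential f x" "v \<in> subdifferential f y"
  shows "(u - v) \<bullet> (x - y) \<ge> 0"
proof -
  have "f y \<ge> f x + u \<bullet> (y - x)" "f x \<ge> f y + v \<bullet> (x - y)"
    using assms unfolding subdifferential_def by auto
  then show ?thesis by (simp add: inner_diff_left inner_diff_right)
qed

text \<open>One bounded subgradient per point suffices, which is what the mean of an unbiased oracle
  provides. The two one-sided estimates use the subgradients at the two endpoints.\<close>

lemma lipschitz_on_bounded_subgradients: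
  fixes f :: "'a::real_inner \<Rightarrow> real"
  assumes "0 \<le> N" and sub: "\<And>x. \<exists>v\<in>subdifferential f x. norm v \<le> N"
  shows "N-lipschitz_on UNIV f"
proof (rule lipschitz_onI)
  have *: "f x - f y \<le> N * norm (x - y)" for x y
  proof -
    obtain v where v: "v \<in> subdifferential f x" "norm v \<le> N" using sub by blast
    have "f x - f y \<le> v \<bullet> (x - y)"
      using v(1) by (auto simp: subdifferential_def inner_diff_right dest: spec[of _ y])
    also have "\<dots> \<le> norm v * norm (x - y)" by (rule norm_cauchy_schwarz)
    also have "\<dots> \<le> N * norm (x - y)" using v(2) by (intro mult_right_mono) auto
    finally show ?thesis .
  qed
  show "dist (f x) (f y) \<le> N * dist x y" for x y
    using *[of x y] *[of y x] by (simp add: dist_norm norm_minus_commute)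
qed fact

subsection \<open>Proximal map and Moreau envelope\<close>

lemma norm_add_sq: "(norm (a + b))\<^sup>2 = (norm a)\<^sup>2 + 2 * (a \<bullet> b) + (norm (b::'a::real_inner))\<^sup>2"
  by (simp add: power2_norm_eq_inner inner_add_left inner_add_right inner_commute)

text \<open>Lipschitz continuity of \<open>g\<close> is the trace left by the second moment bound of
  the oracle. It makes the proximal objective coercive and bounds the gradient of the
  envelope.\<close>

locale lipschitz_convex =
  fixes g :: "'a::euclidean_space \<Rightarrow> real" and N \<gamma> :: real
  assumes cvx: "convex_on UNIV g" and lip: "N-lipschitz_on UNIV g" and \<gamma>: "0 < \<gamma>"
begin

text \<open>As \<open>prox\<close> is defined by choice, a minimiser has to be exhibited. Outside
  the ball of radius 2 \<gamma> N around \<open>x\<close> the quadratic term outweighs the at most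
  linear decrease of \<gamma> g, so a minimiser over this compact ball is a global one.\<close>

lemma prox_le:
  "\<gamma> * g (prox \<gamma> g x) + 1/2 * (norm (prox \<gamma> g x - x))\<^sup>2 \<le> \<gamma> * g y + 1/2 * (norm (y - x))\<^sup>2"
proof -
  define q where "q = (\<lambda>y. \<gamma> * g y + 1/2 * (norm (y - x))\<^sup>2)"
  have N: "0 \<le> N" using lip by (rule lipschitz_on_nonneg)
  have "continuous_on UNIV q"
    unfolding q_def by (intro continuous_intros lipschitz_on_continuous_on[OF lip])
  then have "continuous_on (cball x (2 * \<gamma> * N)) q" by (rule continuous_on_subset) simp
  moreover have "cball x (2 * \<gamma> * N) \<noteq> {}" using N \<gamma> by (simp add: not_less)
  ultimately obtain p where p: "\<And>y. y \<in> cball x (2 * \<gamma> * N) \<Longrightarrow> q p \<le> q y"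
    using continuous_attains_inf[of "cball x (2 * \<gamma> * N)" q] by (auto simp del: mem_cball)
  have "q p \<le> q y" for y
  proof (cases "y \<in> cball x (2 * \<gamma> * N)")
    case False
    then have r: "2 * (\<gamma> * N) \<le> norm (y - x)" by (simp add: dist_norm norm_minus_commute)
    have "g x - g y \<le> N * norm (y - x)"
      using lipschitz_onD[OF lip, of x y] by (simp add: dist_norm norm_minus_commute)
    then have "\<gamma> * g x - \<gamma> * g y \<le> \<gamma> * N * norm (y - x)"
      using \<gamma> by (metis mult.assoc mult_left_mono less_imp_le right_diff_distrib)
    also have "\<dots> \<le> 1/2 * (norm (y - x))\<^sup>2"
      using mult_right_mono[OF r norm_ge_zero[of "y - x"]] by (simp add: power2_eq_square)
    finally have "q x \<le> q y" by (simp add: q_def)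
    moreover have "q p \<le> q x" using p[of x] N \<gamma> by simp
    ultimately show ?thesis by simp
  qed (rule p)
  then have "is_arg_min q (\<lambda>y. True) p" by (auto simp: is_arg_min_def not_less)
  then have "is_arg_min q (\<lambda>y. True) (prox \<gamma> g x)"
    unfolding prox_def arg_min_def q_def by (rule someI)
  then have "q (prox \<gamma> g x) \<le> q y" by (auto simp: is_arg_min_def not_less)
  then show ?thesis by (simp add: q_def)
qed

text \<open>First-order optimality: the minimiser \<open>p\<close> is compared with p + t (y - p),
  convexity bounds \<open>g\<close> there, and after division by t the remaining quadratic term
  vanishes as t tends to 0 from the right.\<close>

lemma prox_subgradient: "(x - prox \<gamma> g x) /\<^sub>R \<gamma> \<in> subdifferential g (prox \<gamma> g x)"
  unfolding subdifferential_def
proof (intro CollectI allI)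
  fix y
  define p where "p = prox \<gamma> g x"
  \<comment> \<open>\<open>K\<close> is \<gamma> times the slack in the desired subgradient
    inequality, so the goal amounts to \<open>0 \<le> K\<close>.\<close>
  define K where "K = \<gamma> * (g y - g p) - (x - p) \<bullet> (y - p)"
  have ev: "0 \<le> K + t / 2 * (norm (y - p))\<^sup>2" if t: "0 < t" "t < 1" for t
  proof -
    have "g ((1 - t) *\<^sub>R p + t *\<^sub>R y) \<le> (1 - t) * g p + t * g y"
      using convex_onD[OF cvx] t by simp
    then have "\<gamma> * g (p + t *\<^sub>R (y - p)) \<le> \<gamma> * ((1 - t) * g p + t * g y)"
      using \<gamma> by (intro mult_left_mono) (auto simp: algebra_simps)
    moreover have "\<gamma> * g p + 1/2 * (norm (p - x))\<^sup>2
      \<le> \<gamma> * g (p + t *\<^sub>R (y - p)) + 1/2 * (norm ((p - x) + t *\<^sub>R (y - p)))\<^sup>2"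
      using prox_le[of x "p + t *\<^sub>R (y - p)"] by (simp add: p_def algebra_simps)
    moreover have "(norm ((p - x) + t *\<^sub>R (y - p)))\<^sup>2
      = (norm (p - x))\<^sup>2 - 2 * t * ((x - p) \<bullet> (y - p)) + t * t * (norm (y - p))\<^sup>2"
      unfolding norm_add_sq
      by (simp add: power_mult_distrib power2_eq_square[of t] minus_diff_eq[of x p, symmetric]
          del: minus_diff_eq)
    moreover have "\<gamma> * ((1 - t) * g p + t * g y) = \<gamma> * g p + t * (\<gamma> * (g y - g p))"
      by (simp add: algebra_simps)
    moreover have "t * (K + t / 2 * (norm (y - p))\<^sup>2)
      = t * (\<gamma> * (g y - g p)) - t * ((x - p) \<bullet> (y - p)) + 1/2 * (t * t * (norm (y - p))\<^sup>2)"
      by (simp add: K_def algebra_simps)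
    ultimately have "0 \<le> t * (K + t / 2 * (norm (y - p))\<^sup>2)" by linarith
    then show ?thesis using t by (simp add: zero_le_mult_iff)
  qed
  have "((\<lambda>t. K + t / 2 * (norm (y - p))\<^sup>2) \<longlongrightarrow> K + 0 / 2 * (norm (y - p))\<^sup>2) (at_right 0)"
    by (intro tendsto_intros) auto
  moreover have "eventually (\<lambda>t::real. 0 \<le> K + t / 2 * (norm (y - p))\<^sup>2) (at_right 0)"
    unfolding eventually_at_right_field using ev by (intro exI[of _ 1]) auto
  ultimately have "0 \<le> K"
    by (intro tendsto_lowerbound[where F = "at_right (0::real)"]) auto
  then have "((x - p) \<bullet> (y - p)) / \<gamma> \<le> g y - g p"
    using \<gamma> by (simp add: K_def pos_divide_le_eq mult.commute)
  then show "g y \<ge> g (prox \<gamma> g x) + ((x - prox \<gamma> g x) /\<^sub>R \<gamma>) \<bullet> (y - prox \<gamma> g x)"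
    by (simp add: p_def[symmetric] divide_inverse mult.commute)
qed

text \<open>Monotonicity of the subdifferential at the two proximal points bounds |p - q|^2 by the
  inner product of x - y and p - q; Cauchy-Schwarz then finishes.\<close>

lemma prox_nonexpansive: "norm (prox \<gamma> g x - prox \<gamma> g y) \<le> norm (x - y)"
proof -
  define p q where "p = prox \<gamma> g x" and "q = prox \<gamma> g y"
  have "0 \<le> ((x - p) /\<^sub>R \<gamma> - (y - q) /\<^sub>R \<gamma>) \<bullet> (p - q)"
    unfolding p_def q_def by (intro subdifferential_monotone[of _ g] prox_subgradient)
  then have "0 \<le> ((x - p) - (y - q)) \<bullet> (p - q)"
    using \<gamma> by (simp add: scaleR_diff_right[symmetric] zero_le_mult_iff)
  then have "(p - q) \<bullet> (p - q) \<le> (x - y) \<bullet> (p - q)"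
    by (simp add: algebra_simps)
  also have "\<dots> \<le> norm (x - y) * norm (p - q)" by (rule norm_cauchy_schwarz)
  finally have "norm (p - q) * norm (p - q) \<le> norm (x - y) * norm (p - q)"
    by (simp add: dot_square_norm power2_eq_square)
  then show ?thesis unfolding p_def q_def
    by (metis mult_right_le_imp_le norm_ge_zero order_le_less)
qed

lemma prox_dist_le: "norm ((x - prox \<gamma> g x) /\<^sub>R \<gamma>) \<le> N"
  using subdifferential_norm_le[OF lip prox_subgradient] .

lemma continuous_on_prox: "continuous_on UNIV (prox \<gamma> g)"
  by (rule lipschitz_on_continuous_on[of 1])
     (auto intro!: lipschitz_onI simp: dist_norm prox_nonexpansive)

lemma moreau_envelope_eq:
  "moreau_envelope \<gamma> g x = g (prox \<gamma> g x) + 1 / (2 * \<gamma>) * (norm (prox \<gamma> g x - x))\<^sup>2"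
  and moreau_envelope_le: "moreau_envelope \<gamma> g x \<le> g y + 1 / (2 * \<gamma>) * (norm (y - x))\<^sup>2"
proof -
  let ?F = "\<lambda>y. g y + 1 / (2 * \<gamma>) * (norm (y - x))\<^sup>2"
  have *: "?F (prox \<gamma> g x) \<le> ?F y" for y
  proof -
    have "?F y = (\<gamma> * g y + 1/2 * (norm (y - x))\<^sup>2) / \<gamma>" for y
      using \<gamma> by (simp add: add_divide_distrib)
    then show ?thesis using prox_le[of x y] \<gamma> by (simp add: divide_right_mono)
  qed
  then show eq: "moreau_envelope \<gamma> g x = ?F (prox \<gamma> g x)"
    unfolding moreau_envelope_def by (intro cInf_eq_minimum) auto
  show "moreau_envelope \<gamma> g x \<le> ?F y" unfolding eq by (rule *)
qed

text \<open>The proximal point of \<open>x\<close> is a candidate in the minimisation at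
  \<open>z\<close>; expanding the square around \<open>x\<close> yields the bound.\<close>

lemma moreau_envelope_upper:
  "moreau_envelope \<gamma> g z \<le> moreau_envelope \<gamma> g x + ((x - prox \<gamma> g x) /\<^sub>R \<gamma>) \<bullet> (z - x)
     + 1 / (2 * \<gamma>) * (norm (z - x))\<^sup>2"
proof -
  define p where "p = prox \<gamma> g x"
  have "moreau_envelope \<gamma> g z \<le> g p + 1 / (2 * \<gamma>) * (norm ((p - x) + (x - z)))\<^sup>2"
    using moreau_envelope_le[of z p] by simp
  also have "\<dots> = moreau_envelope \<gamma> g x + ((x - p) /\<^sub>R \<gamma>) \<bullet> (z - x)
     + 1 / (2 * \<gamma>) * (norm (z - x))\<^sup>2"
    unfolding norm_add_sq moreau_envelope_eq p_def[symmetric] norm_minus_commute[of x z] using \<gamma>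
    by (simp add: field_simps inner_diff_left inner_diff_right)
  finally show ?thesis unfolding p_def .
qed

text \<open>The quadratic upper bound, used from \<open>x\<close> to \<open>z\<close> and from
  \<open>z\<close> to \<open>x\<close>, traps the linearisation error. The reverse bound has its
  slope at \<open>z\<close>, which Lipschitz continuity of \<open>?s\<close> moves to
  \<open>x\<close>.\<close>

lemma moreau_envelope_GDERIV: "GDERIV (moreau_envelope \<gamma> g) x :> (x - prox \<gamma> g x) /\<^sub>R \<gamma>"
proof -
  let ?e = "moreau_envelope \<gamma> g" and ?s = "\<lambda>x. (x - prox \<gamma> g x) /\<^sub>R \<gamma>"
  \<comment> \<open>The 3 is 2 from the crude Lipschitz constant 2 / \<gamma> of \<open>?s\<close>,
    plus 1/2 from the upper bound, rounded up to 1.\<close>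
  have bd: "norm (?e z - ?e x - (z - x) \<bullet> ?s x) \<le> 3 / \<gamma> * (norm (z - x))\<^sup>2" for z
  proof -
    have "norm (?s z - ?s x) \<le> 2 / \<gamma> * norm (z - x)"
    proof -
      have "?s z - ?s x = ((z - x) - (prox \<gamma> g z - prox \<gamma> g x)) /\<^sub>R \<gamma>"
        by (simp add: algebra_simps)
      moreover have "norm ((z - x) - (prox \<gamma> g z - prox \<gamma> g x)) \<le> 2 * norm (z - x)"
        using norm_triangle_ineq4[of "z - x" "prox \<gamma> g z - prox \<gamma> g x"] prox_nonexpansive[of z x]
        by simp
      ultimately show ?thesis using \<gamma> by (simp add: divide_simps)
    qed
    then have "\<bar>(?s z - ?s x) \<bullet> (z - x)\<bar> \<le> 2 / \<gamma> * norm (z - x) * norm (z - x)"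
      by (meson Cauchy_Schwarz_ineq2 mult_right_mono norm_ge_zero order_trans)
    then have "- (2 / \<gamma> * (norm (z - x))\<^sup>2) \<le> ?s z \<bullet> (z - x) - ?s x \<bullet> (z - x)"
      by (simp add: inner_diff_left power2_eq_square)
    moreover have "?e x \<le> ?e z - ?s z \<bullet> (z - x) + 1 / (2 * \<gamma>) * (norm (z - x))\<^sup>2"
      using moreau_envelope_upper[of x z]
      by (simp add: norm_minus_commute inner_diff_right)
    moreover have "?e z \<le> ?e x + ?s x \<bullet> (z - x) + 1 / (2 * \<gamma>) * (norm (z - x))\<^sup>2"
      by (rule moreau_envelope_upper)
    moreover have "1 / (2 * \<gamma>) * (norm (z - x))\<^sup>2 \<le> 1 / \<gamma> * (norm (z - x))\<^sup>2"
      using \<gamma> by (intro mult_right_mono) (auto simp: field_simps)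
    moreover have "3 / \<gamma> * (norm (z - x))\<^sup>2 = 2 / \<gamma> * (norm (z - x))\<^sup>2 + 1 / \<gamma> * (norm (z - x))\<^sup>2"
      by (simp add: field_simps)
    moreover have "0 \<le> 1 / \<gamma> * (norm (z - x))\<^sup>2"  "0 \<le> 2 / \<gamma> * (norm (z - x))\<^sup>2"
      using \<gamma> by auto
    ultimately show ?thesis by (simp only: inner_commute[of "z - x"] real_norm_def abs_le_iff) linarith
  qed
  show ?thesis unfolding gderiv_def has_derivative_iff_norm
  proof (intro conjI)
    show "bounded_linear (\<lambda>h. h \<bullet> ?s x)" by (rule bounded_linear_inner_left)
    have "((\<lambda>z. 3 / \<gamma> * norm (z - x)) \<longlongrightarrow> 3 / \<gamma> * norm (x - x)) (at x)"
      by (intro tendsto_intros)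
    then have lim: "((\<lambda>z. 3 / \<gamma> * norm (z - x)) \<longlongrightarrow> 0) (at x)" by simp
    show "((\<lambda>z. norm (?e z - ?e x - (z - x) \<bullet> ?s x) / norm (z - x)) \<longlongrightarrow> 0) (at x)"
    proof (rule tendsto_sandwich[OF _ _ tendsto_const lim])
      show "\<forall>\<^sub>F z in at x. 0 \<le> norm (?e z - ?e x - (z - x) \<bullet> ?s x) / norm (z - x)" by simp
      show "\<forall>\<^sub>F z in at x. norm (?e z - ?e x - (z - x) \<bullet> ?s x) / norm (z - x) \<le> 3 / \<gamma> * norm (z - x)"
        using eventually_neq_at_within[of x]
        by (rule eventually_mono)
           (use bd in \<open>simp add: pos_divide_le_eq power2_eq_square mult.assoc\<close>)
    qed
  qed
qed

end

subsection \<open>The difference-of-convex objective\<close>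

text \<open>This is Young's inequality with the weight that turns the factor (1 - b)^2 into 1 - b.
  It is applied with \<open>u\<close> an old tracking error, \<open>w\<close> the drift of the
  tracked point and \<open>b\<close> the contraction rate.\<close>

lemma young_contraction:
  fixes u w :: "'a::real_inner"
  assumes b: "0 < b" "b \<le> 1"
  shows "(1 - b)\<^sup>2 * (norm (u + w))\<^sup>2 \<le> (1 - b) * (norm u)\<^sup>2 + 1 / b * (norm w)\<^sup>2"
proof -
  \<comment> \<open>This square encodes Young's inequality without dividing by 1 - b, so that b = 1
    is covered.\<close>
  have "0 \<le> (norm (b *\<^sub>R u + (- (1 - b)) *\<^sub>R w))\<^sup>2" by simp
  also have "\<dots> = b\<^sup>2 * (norm u)\<^sup>2 - 2 * b * (1 - b) * (u \<bullet> w) + (1 - b)\<^sup>2 * (norm w)\<^sup>2"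
    unfolding norm_add_sq 
    by (simp add: power_mult_distrib power2_commute[of b 1]) (simp add: algebra_simps)
  finally have "2 * b * (1 - b) * (u \<bullet> w) \<le> b\<^sup>2 * (norm u)\<^sup>2 + (1 - b)\<^sup>2 * (norm w)\<^sup>2" by simp
  then have "(1 - b) * (norm (u + w))\<^sup>2 * b
      \<le> (1 - b) * b * (norm u)\<^sup>2 + (1 - b) * b * (norm w)\<^sup>2
        + (b\<^sup>2 * (norm u)\<^sup>2 + (1 - b)\<^sup>2 * (norm w)\<^sup>2)"
    unfolding norm_add_sq by (simp add: algebra_simps)
  also have "\<dots> = b * (norm u)\<^sup>2 + (1 - b) * (norm w)\<^sup>2"
    by (simp add: power2_eq_square algebra_simps)
  also have "\<dots> \<le> b * (norm u)\<^sup>2 + (norm w)\<^sup>2"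
    using b by (simp add: mult_left_le_one_le)
  finally have "(1 - b) * (norm (u + w))\<^sup>2 \<le> (b * (norm u)\<^sup>2 + (norm w)\<^sup>2) / b"
    using b by (simp add: pos_le_divide_eq)
  also have "\<dots> = (norm u)\<^sup>2 + 1 / b * (norm w)\<^sup>2" using b by (simp add: field_simps)
  finally have "(1 - b) * ((1 - b) * (norm (u + w))\<^sup>2) \<le> (1 - b) * ((norm u)\<^sup>2 + 1 / b * (norm w)\<^sup>2)"
    using b by (intro mult_left_mono) auto
  also have "\<dots> \<le> (1 - b) * (norm u)\<^sup>2 + 1 / b * (norm w)\<^sup>2"
    unfolding distrib_left using b by (intro add_left_mono mult_left_le_one_le) auto
  finally show ?thesis by (simp add: power2_eq_square mult.assoc)
qed

lemma norm_add_sq_le: "(norm (a + b :: 'a::real_inner))\<^sup>2 \<le> 2 * (norm a)\<^sup>2 + 2 * (norm b)\<^sup>2"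
  using norm_add_sq[of a b] norm_add_sq[of a "-b"] zero_le_power2[of "norm (a + - b)"] by simp

locale moreau_dc = lipschitz_convex g N \<gamma>
  for g :: "'a::euclidean_space \<Rightarrow> real" and N \<gamma> :: real +
  fixes h :: "'a \<Rightarrow> real" and L :: real
  assumes cvx_h: "convex_on UNIV h" and smooth_h: "smooth_fun L h" and L: "0 < L"
    and bdd: "bdd_below (range (\<lambda>z. moreau_envelope \<gamma> g z - h z))"
begin

definition f :: "'a \<Rightarrow> real" where "f z = moreau_envelope \<gamma> g z - h z"

definition f_inf :: real where "f_inf = (INF z. f z)"

lemma f_inf_le: "f_inf \<le> f z"
  unfolding f_inf_def using bdd by (intro cINF_lower) (auto simp: f_def)

lemma GDERIV_h: "GDERIV h x :> grad h x"
  using smooth_h by (intro differentiable_imp_GDERIV_grad) (simp add: smooth_fun_def)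

lemma h_above_tangent: "h x + grad h x \<bullet> (y - x) \<le> h y"
  using convex_GDERIV_in_subdifferential[OF cvx_h GDERIV_h, of x]
  unfolding subdifferential_def by blast

lemma grad_h_lipschitz: "norm (grad h x - grad h y) \<le> L * norm (x - y)"
  using smooth_h by (auto simp: smooth_fun_def dist_norm dest: lipschitz_onD)

lemma continuous_on_grad_h: "continuous_on UNIV (grad h)"
  using smooth_h by (auto simp: smooth_fun_def intro: lipschitz_on_continuous_on)

lemma GDERIV_f: "GDERIV f x :> (x - prox \<gamma> g x) /\<^sub>R \<gamma> - grad h x"
  unfolding f_def[abs_def] by (intro GDERIV_diff moreau_envelope_GDERIV GDERIV_h)

lemma grad_f: "grad f x = (x - prox \<gamma> g x) /\<^sub>R \<gamma> - grad h x"
  by (rule grad_eqI[OF GDERIV_f])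

lemma continuous_on_f: "continuous_on UNIV f"
  using GDERIV_f unfolding gderiv_def
  by (auto intro!: continuous_at_imp_continuous_on dest: has_derivative_continuous)

text \<open>The tangent inequality of the convex \<open>h\<close> enters with a favourable sign, so
  the curvature comes from the envelope alone.\<close>

lemma f_upper: "f z \<le> f x + grad f x \<bullet> (z - x) + 1 / (2 * \<gamma>) * (norm (z - x))\<^sup>2"
proof -
  show ?thesis
    using h_above_tangent[of x z] moreau_envelope_upper[of z x] unfolding f_def grad_f inner_diff_left[of _ "grad h x"]
    by linarith
qed

text \<open>Since \<open>h \<le> g - inf f\<close> and \<open>g\<close> grows at most linearly, the convex function \<open>h\<close>
  cannot have a slope larger than \<open>N\<close> anywhere.\<close>

lemma norm_grad_h_le: "norm (grad h x) \<le> N"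
proof (rule ccontr)
  assume "\<not> norm (grad h x) \<le> N"
  then have gt: "N < norm (grad h x)" by simp
  have N: "0 \<le> N" using lip by (rule lipschitz_on_nonneg)
  define c where "c = norm (grad h x) * (norm (grad h x) - N)"
  have c: "0 < c" unfolding c_def using gt N by (intro mult_pos_pos) auto
  have bound: "r * c \<le> g x - f_inf - h x" if "0 \<le> r" for r
  proof -
    \<comment> \<open>Along its own gradient, \<open>h\<close> grows at rate at least |grad h x|^2
      and \<open>g\<close> at rate at most N |grad h x|; \<open>c\<close> is the difference of these
      rates.\<close>
    let ?y = "x + r *\<^sub>R grad h x"
    have "h x + grad h x \<bullet> (?y - x) \<le> h ?y"
      by (rule h_above_tangent)
    moreover have "h ?y \<le> g ?y - f_inf"
      using f_inf_le[of ?y] moreau_envelope_le[of ?y ?y] by (simp add: f_def)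
    moreover have "g ?y \<le> g x + N * (r * norm (grad h x))"
      using lipschitz_onD[OF lip, of ?y x] that by (simp add: dist_norm)
    ultimately show ?thesis
      by (simp add: c_def dot_square_norm power2_eq_square algebra_simps)
  qed
  \<comment> \<open>At r = \<open>?K / c\<close> the left side of \<open>bound\<close> equals
    \<open>?K\<close>, which exceeds the right side by at least 1.\<close>
  let ?K = "\<bar>g x - f_inf - h x\<bar> + 1"
  have "?K / c * c \<le> g x - f_inf - h x" using c by (intro bound) auto
  then show False using c by simp
qed

lemma norm_grad_f_le: "norm (grad f x) \<le> 2 * N"
  using norm_triangle_ineq4[of "(x - prox \<gamma> g x) /\<^sub>R \<gamma>" "grad h x"] prox_dist_le[of x]
    norm_grad_h_le[of x] unfolding grad_f by linarith

text \<open>Here \<open>y\<close> is the already updated proximal iterate. The squared contraction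
  factors on the left are those of the next stochastic updates before their noise is added. The
  decrease of the two error terms cancels exactly the bias \<open>D\<close>, \<open>\<Delta>\<close>
  in the descent of \<open>f\<close>, and the drift of their targets is paid for by the squared step
  \<open>V\<close>.\<close>

lemma lyapunov_step:
  fixes \<eta> \<eta>1 \<alpha> :: real and x y m :: 'a
  assumes \<eta>: "0 < \<eta>" and \<eta>1: "\<eta>1 = sqrt 32 * \<eta>" "\<eta>1 \<le> \<gamma>"
    and \<alpha>: "\<alpha> = 2 * sqrt 2 * L * \<eta>" "\<alpha> \<le> 1"
    and x': "x' = x - \<eta> *\<^sub>R ((x - y) /\<^sub>R \<gamma> - m)"
  shows "f x' + \<eta> / (\<gamma> * \<eta>1) * ((1 - \<eta>1 / \<gamma>)\<^sup>2 * (norm (y - prox \<gamma> g x'))\<^sup>2)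
        + \<eta> / \<alpha> * ((1 - \<alpha>)\<^sup>2 * (norm (m - grad h x'))\<^sup>2)
      \<le> f x + \<eta> / (\<gamma> * \<eta>1) * (norm (y - prox \<gamma> g x))\<^sup>2
        + \<eta> / \<alpha> * (norm (m - grad h x))\<^sup>2 - \<eta> / 2 * (norm (grad f x))\<^sup>2"
proof -
  define v where "v = (x - y) /\<^sub>R \<gamma> - m"
  define D where "D = y - prox \<gamma> g x"
  define \<Delta> where "\<Delta> = m - grad h x"
  define V where "V = (norm v)\<^sup>2"
  have x'v: "x' - x = - (\<eta> *\<^sub>R v)" by (simp add: x' v_def)
  have \<eta>1_pos: "0 < \<eta>1" and \<alpha>_pos: "0 < \<alpha>" using \<eta> L by (auto simp: \<eta>1 \<alpha>)
  have b: "0 < \<eta>1 / \<gamma>" "\<eta>1 / \<gamma> \<le> 1" using \<eta>1_pos \<eta>1(2) \<gamma> by auto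
  have nx: "norm (x - x') = \<eta> * norm v" using \<eta> x'v by (metis abs_of_pos norm_minus_cancel norm_minus_commute norm_scaleR)
  have prox_part: "\<eta> / (\<gamma> * \<eta>1) * ((1 - \<eta>1 / \<gamma>)\<^sup>2 * (norm (y - prox \<gamma> g x'))\<^sup>2)
      \<le> \<eta> / (\<gamma> * \<eta>1) * (norm D)\<^sup>2 - \<eta> / \<gamma>\<^sup>2 * (norm D)\<^sup>2 + \<eta> / 32 * V"
  proof -
    let ?w = "prox \<gamma> g x - prox \<gamma> g x'"
    have w: "(norm ?w)\<^sup>2 \<le> \<eta>\<^sup>2 * V"
      using power_mono[OF prox_nonexpansive[of x x'] norm_ge_zero, of 2]
      by (simp add: nx V_def power_mult_distrib)
    have "(1 - \<eta>1 / \<gamma>)\<^sup>2 * (norm (D + ?w))\<^sup>2 \<le> (1 - \<eta>1 / \<gamma>) * (norm D)\<^sup>2 + 1 / (\<eta>1 / \<gamma>) * (norm ?w)\<^sup>2"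
      by (rule young_contraction[OF b])
    also have "\<dots> \<le> (1 - \<eta>1 / \<gamma>) * (norm D)\<^sup>2 + 1 / (\<eta>1 / \<gamma>) * (\<eta>\<^sup>2 * V)"
      using \<eta>1_pos \<gamma> w by (intro add_left_mono mult_left_mono) auto
    finally have "\<eta> / (\<gamma> * \<eta>1) * ((1 - \<eta>1 / \<gamma>)\<^sup>2 * (norm (D + ?w))\<^sup>2)
        \<le> \<eta> / (\<gamma> * \<eta>1) * ((1 - \<eta>1 / \<gamma>) * (norm D)\<^sup>2 + 1 / (\<eta>1 / \<gamma>) * (\<eta>\<^sup>2 * V))"
      using \<eta> \<gamma> \<eta>1_pos by (intro mult_left_mono) auto
    also have "\<dots> = \<eta> / (\<gamma> * \<eta>1) * (norm D)\<^sup>2 - \<eta> / \<gamma>\<^sup>2 * (norm D)\<^sup>2 + \<eta> * (\<eta>\<^sup>2 / \<eta>1\<^sup>2) * V"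
      using \<gamma> \<eta>1_pos by (simp add: field_simps power2_eq_square)
    \<comment> \<open>The ratio of \<eta>1 to \<eta> makes the drift cost of the proximal point
      \<eta> V / 32.\<close>
    also have "\<eta>\<^sup>2 / \<eta>1\<^sup>2 = 1 / 32" using \<eta> by (simp add: \<eta>1(1) power_mult_distrib)
    finally show ?thesis by (simp add: D_def)
  qed
  have mom_part: "\<eta> / \<alpha> * ((1 - \<alpha>)\<^sup>2 * (norm (m - grad h x'))\<^sup>2)
      \<le> \<eta> / \<alpha> * (norm \<Delta>)\<^sup>2 - \<eta> * (norm \<Delta>)\<^sup>2 + \<eta> / 8 * V"
  proof -
    let ?w = "grad h x - grad h x'"
    have w: "(norm ?w)\<^sup>2 \<le> L\<^sup>2 * \<eta>\<^sup>2 * V"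
      using power_mono[OF grad_h_lipschitz[of x x'] norm_ge_zero, of 2]
      by (simp add: nx V_def power_mult_distrib)
    have "(1 - \<alpha>)\<^sup>2 * (norm (\<Delta> + ?w))\<^sup>2 \<le> (1 - \<alpha>) * (norm \<Delta>)\<^sup>2 + 1 / \<alpha> * (norm ?w)\<^sup>2"
      by (rule young_contraction[OF \<alpha>_pos \<alpha>(2)])
    also have "\<dots> \<le> (1 - \<alpha>) * (norm \<Delta>)\<^sup>2 + 1 / \<alpha> * (L\<^sup>2 * \<eta>\<^sup>2 * V)"
      using \<alpha>_pos w by (intro add_left_mono mult_left_mono) auto
    finally have "\<eta> / \<alpha> * ((1 - \<alpha>)\<^sup>2 * (norm (\<Delta> + ?w))\<^sup>2)
        \<le> \<eta> / \<alpha> * ((1 - \<alpha>) * (norm \<Delta>)\<^sup>2 + 1 / \<alpha> * (L\<^sup>2 * \<eta>\<^sup>2 * V))"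
      using \<eta> \<alpha>_pos by (intro mult_left_mono) auto
    also have "\<dots> = \<eta> / \<alpha> * (norm \<Delta>)\<^sup>2 - \<eta> * (norm \<Delta>)\<^sup>2 + \<eta> * (L\<^sup>2 * \<eta>\<^sup>2 / \<alpha>\<^sup>2) * V"
      using \<alpha>_pos by (simp add: field_simps power2_eq_square)
    \<comment> \<open>Likewise the choice of \<alpha> makes the drift cost of the gradient \<eta> V
      / 8.\<close>
    also have "L\<^sup>2 * \<eta>\<^sup>2 / \<alpha>\<^sup>2 = 1 / 8" using \<eta> L by (simp add: \<alpha>(1) power_mult_distrib)
    finally show ?thesis by (simp add: \<Delta>_def)
  qed
  have f_part: "f x' \<le> f x - \<eta> / 2 * (norm (grad f x))\<^sup>2 - 2 / 5 * \<eta> * V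
      + \<eta> / \<gamma>\<^sup>2 * (norm D)\<^sup>2 + \<eta> * (norm \<Delta>)\<^sup>2"
  proof -
    define e where "e = v - grad f x"
    have e: "e = (- 1 / \<gamma>) *\<^sub>R D + (- \<Delta>)"
      by (simp add: e_def v_def grad_f D_def \<Delta>_def field_simps)
    have ee: "(norm e)\<^sup>2 \<le> 2 * (1 / \<gamma>\<^sup>2 * (norm D)\<^sup>2) + 2 * (norm \<Delta>)\<^sup>2"
      using norm_add_sq_le[of "(- 1 / \<gamma>) *\<^sub>R D" "- \<Delta>"]
      by (simp add: e power_mult_distrib power_divide)
    have "(norm e)\<^sup>2 = V - 2 * (grad f x \<bullet> v) + (norm (grad f x))\<^sup>2"
      unfolding e_def V_def power2_norm_eq_inner by (simp add: inner_commute inner_diff_left inner_diff_right)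
    \<comment> \<open>Polarisation: the inner product yields both -|grad f|^2 and -V, at the price
      of the squared bias of the direction \<open>v\<close>.\<close>
    then have gv: "grad f x \<bullet> v = (V + (norm (grad f x))\<^sup>2 - (norm e)\<^sup>2) / 2" by simp
    \<comment> \<open>As 25 \<le> 32 and \<eta>1 \<le> \<gamma>, the curvature term costs at most
      \<eta> V / 10; of the available \<eta> V / 2 this leaves 2/5.\<close>
    have "5 * \<eta> \<le> \<eta>1" using \<eta> real_le_rsqrt[of 5 32] by (simp add: \<eta>1)
    then have \<eta>\<gamma>: "\<eta> / \<gamma> \<le> 1 / 5" using \<eta>1(2) \<gamma> by (simp add: field_simps)
    have V: "0 \<le> V" by (simp add: V_def)
    have "f x' \<le> f x - \<eta> * (grad f x \<bullet> v) + 1 / (2 * \<gamma>) * (\<eta>\<^sup>2 * V)"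
      using f_upper[of x' x] \<eta> unfolding x'v by (simp add: V_def power_mult_distrib)
    also have "1 / (2 * \<gamma>) * (\<eta>\<^sup>2 * V) = \<eta> / 2 * V * (\<eta> / \<gamma>)" by (simp add: power2_eq_square)
    also have "\<dots> \<le> \<eta> / 2 * V * (1 / 5)"
      using \<eta>\<gamma> \<eta> V by (intro mult_left_mono) auto
    also have "f x - \<eta> * (grad f x \<bullet> v) + \<eta> / 2 * V * (1 / 5)
        = f x - \<eta> / 2 * (norm (grad f x))\<^sup>2 - 2 / 5 * \<eta> * V + \<eta> / 2 * (norm e)\<^sup>2"
      unfolding gv by (simp add: field_simps)
    also have "\<eta> / 2 * (norm e)\<^sup>2 \<le> \<eta> / 2 * (2 * (1 / \<gamma>\<^sup>2 * (norm D)\<^sup>2) + 2 * (norm \<Delta>)\<^sup>2)"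
      using ee \<eta> by (intro mult_left_mono) auto
    finally show ?thesis by (simp add: algebra_simps)
  qed
  \<comment> \<open>The two drift costs fit into what is left: 1/32 + 1/8 = 5/32 \<le> 2/5.\<close>
  have "0 \<le> \<eta> * V" using \<eta> by (simp add: V_def)
  then have "\<eta> / 32 * V + \<eta> / 8 * V \<le> 2 / 5 * \<eta> * V" by (simp add: mult.commute[of V])
  then show ?thesis
    using prox_part mom_part f_part unfolding D_def[symmetric] \<Delta>_def[symmetric] by linarith
qed

end

subsection \<open>Fresh samples\<close>

text \<open>Independence of generated \<sigma>-algebras becomes a product law for variables
  measurable with respect to them, since a product measure is determined by rectangles.\<close>

lemma (in prob_space) indep_set_joint_distr:
  assumes ind: "indep_set (sets F) (sets G)" and sp: "space F = space M" "space G = space M"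
    and X: "X \<in> F \<rightarrow>\<^sub>M S" and Y: "Y \<in> G \<rightarrow>\<^sub>M D"
  shows "X \<in> M \<rightarrow>\<^sub>M S" and "Y \<in> M \<rightarrow>\<^sub>M D"
    and "distr M (S \<Otimes>\<^sub>M D) (\<lambda>\<omega>. (X \<omega>, Y \<omega>)) = distr M S X \<Otimes>\<^sub>M distr M D Y"
proof -
  have sub: "sets F \<subseteq> events" "sets G \<subseteq> events"
    using indep_setD_ev1[OF ind] indep_setD_ev2[OF ind] by auto
  show rvX [measurable]: "X \<in> M \<rightarrow>\<^sub>M S" and rvY [measurable]: "Y \<in> M \<rightarrow>\<^sub>M D"
    using X Y sub sp unfolding measurable_def by auto
  interpret X: prob_space "distr M S X" by (rule prob_space_distr) fact
  interpret Y: prob_space "distr M D Y" by (rule prob_space_distr) fact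
  show "distr M (S \<Otimes>\<^sub>M D) (\<lambda>\<omega>. (X \<omega>, Y \<omega>)) = distr M S X \<Otimes>\<^sub>M distr M D Y"
  proof (rule pair_measure_eqI[symmetric])
    show "sigma_finite_measure (distr M S X)" "sigma_finite_measure (distr M D Y)" ..
    show "sets (distr M S X \<Otimes>\<^sub>M distr M D Y) = sets (distr M (S \<Otimes>\<^sub>M D) (\<lambda>\<omega>. (X \<omega>, Y \<omega>)))"
      by simp
  next
    fix A B assume "A \<in> sets (distr M S X)" "B \<in> sets (distr M D Y)"
    then have A [measurable]: "A \<in> sets S" and B [measurable]: "B \<in> sets D" by auto
    have "X -` A \<inter> space M \<in> sets F" "Y -` B \<inter> space M \<in> sets G"
      using measurable_sets[OF X A] measurable_sets[OF Y B] sp by auto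
    then have "prob ((X -` A \<inter> space M) \<inter> (Y -` B \<inter> space M))
        = prob (X -` A \<inter> space M) * prob (Y -` B \<inter> space M)"
      by (rule indep_setD[OF ind])
    moreover have "(X -` A \<inter> space M) \<inter> (Y -` B \<inter> space M)
        = (\<lambda>\<omega>. (X \<omega>, Y \<omega>)) -` (A \<times> B) \<inter> space M" by auto
    ultimately show "emeasure (distr M S X) A * emeasure (distr M D Y) B
        = emeasure (distr M (S \<Otimes>\<^sub>M D) (\<lambda>\<omega>. (X \<omega>, Y \<omega>))) (A \<times> B)"
      by (simp add: emeasure_distr emeasure_eq_measure ennreal_mult)
  qed
qed

text \<open>A conditional expectation bound without conditional expectations: by Tonelli the fresh
  variable \<open>Y\<close> is integrated out first, with \<open>X\<close> frozen. Working with
  nonnegative integrals makes integrability a conclusion.\<close>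

lemma (in prob_space) expectation_indep_le:
  fixes \<phi> :: "'b \<times> 'c \<Rightarrow> real" and \<psi> :: "'b \<Rightarrow> real"
  assumes rvX [measurable]: "X \<in> M \<rightarrow>\<^sub>M S" and rvY [measurable]: "Y \<in> M \<rightarrow>\<^sub>M D"
    and joint: "distr M (S \<Otimes>\<^sub>M D) (\<lambda>\<omega>. (X \<omega>, Y \<omega>)) = distr M S X \<Otimes>\<^sub>M distr M D Y"
    and Y: "distr M D Y = D"
    and \<phi>: "\<phi> \<in> borel_measurable (S \<Otimes>\<^sub>M D)" and nonneg: "\<And>z. 0 \<le> \<phi> z"
    and int: "\<And>a. integrable D (\<lambda>s. \<phi> (a, s))"
    and le: "\<And>a. (\<integral>s. \<phi> (a, s) \<partial>D) \<le> \<psi> a"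
    and \<psi>: "integrable M (\<lambda>\<omega>. \<psi> (X \<omega>))"
  shows "integrable M (\<lambda>\<omega>. \<phi> (X \<omega>, Y \<omega>))"
    and "(\<integral>\<omega>. \<phi> (X \<omega>, Y \<omega>) \<partial>M) \<le> (\<integral>\<omega>. \<psi> (X \<omega>) \<partial>M)"
proof -
  note \<phi> [measurable]
  interpret D: prob_space D using prob_space_distr[OF rvY] by (simp add: Y)
  have \<psi>_nonneg: "0 \<le> \<psi> a" for a
    using Bochner_Integration.integral_nonneg[of D "\<lambda>s. \<phi> (a, s)", OF nonneg] le[of a] by simp
  have "(\<integral>\<^sup>+\<omega>. ennreal (\<phi> (X \<omega>, Y \<omega>)) \<partial>M)
      = (\<integral>\<^sup>+z. ennreal (\<phi> z) \<partial>distr M (S \<Otimes>\<^sub>M D) (\<lambda>\<omega>. (X \<omega>, Y \<omega>)))"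
    by (subst nn_integral_distr) auto
  also have "\<dots> = (\<integral>\<^sup>+a. (\<integral>\<^sup>+s. ennreal (\<phi> (a, s)) \<partial>D) \<partial>distr M S X)"
    unfolding joint Y by (subst D.nn_integral_fst) auto
  also have "\<dots> = (\<integral>\<^sup>+\<omega>. (\<integral>\<^sup>+s. ennreal (\<phi> (X \<omega>, s)) \<partial>D) \<partial>M)"
    by (subst nn_integral_distr) auto
  also have "\<dots> \<le> (\<integral>\<^sup>+\<omega>. ennreal (\<psi> (X \<omega>)) \<partial>M)"
    using le by (intro nn_integral_mono)
      (subst nn_integral_eq_integral, auto intro: int nonneg ennreal_leI)
  also have "\<dots> = ennreal (\<integral>\<omega>. \<psi> (X \<omega>) \<partial>M)"
    using \<psi> \<psi>_nonneg by (intro nn_integral_eq_integral) auto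
  finally have nn: "(\<integral>\<^sup>+\<omega>. ennreal (\<phi> (X \<omega>, Y \<omega>)) \<partial>M) \<le> ennreal (\<integral>\<omega>. \<psi> (X \<omega>) \<partial>M)" .
  then show I: "integrable M (\<lambda>\<omega>. \<phi> (X \<omega>, Y \<omega>))"
    using nonneg by (intro integrableI_nonneg) (auto intro: le_less_trans)
  have "ennreal (\<integral>\<omega>. \<phi> (X \<omega>, Y \<omega>) \<partial>M) \<le> ennreal (\<integral>\<omega>. \<psi> (X \<omega>) \<partial>M)"
    using nn nn_integral_eq_integral[OF I] nonneg by simp
  then show "(\<integral>\<omega>. \<phi> (X \<omega>, Y \<omega>) \<partial>M) \<le> (\<integral>\<omega>. \<psi> (X \<omega>) \<partial>M)"
    using \<psi>_nonneg by (simp add: ennreal_le_iff integral_nonneg_AE)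
qed

text \<open>In the error recursions \<open>u\<close> is the part fixed by the past and
  \<open>Z\<close> the sampled part; the mean of \<open>Z\<close> decides the sign of the cross
  term.\<close>

lemma (in prob_space) expectation_norm_sq_affine:
  fixes Z :: "'a \<Rightarrow> 'b::euclidean_space"
  assumes Z: "integrable M Z" and Z2: "integrable M (\<lambda>s. (norm (Z s))\<^sup>2)"
  shows "integrable M (\<lambda>s. (norm (u + c *\<^sub>R Z s))\<^sup>2)"
    and "(\<integral>s. (norm (u + c *\<^sub>R Z s))\<^sup>2 \<partial>M)
      = (norm u)\<^sup>2 + 2 * c * (u \<bullet> (\<integral>s. Z s \<partial>M)) + c\<^sup>2 * (\<integral>s. (norm (Z s))\<^sup>2 \<partial>M)"
proof -
  have *: "(norm (u + c *\<^sub>R Z s))\<^sup>2 = (norm u)\<^sup>2 + (2 * c) * (u \<bullet> Z s) + c\<^sup>2 * (norm (Z s))\<^sup>2" for s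
    unfolding norm_add_sq by (simp add: power_mult_distrib)
  have i1: "integrable M (\<lambda>s. u \<bullet> Z s)" using Z by (rule integrable_inner_right)
  show "integrable M (\<lambda>s. (norm (u + c *\<^sub>R Z s))\<^sup>2)"
    unfolding * using i1 Z2 by simp
  show "(\<integral>s. (norm (u + c *\<^sub>R Z s))\<^sup>2 \<partial>M)
      = (norm u)\<^sup>2 + 2 * c * (u \<bullet> (\<integral>s. Z s \<partial>M)) + c\<^sup>2 * (\<integral>s. (norm (Z s))\<^sup>2 \<partial>M)"
    unfolding * using i1 Z2 Z by (simp add: prob_space)
qed

text \<open>The variance of the oracle is nonnegative, so its mean, a subgradient, has norm at most
  \<bar>M\<bar>. The absolute value appears because \<open>M\<close> may have either sign.\<close>

lemma unbiased_subgradient_oracle_lipschitz: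
  assumes "unbiased_subgradient_oracle g D dg M"
  shows "\<bar>M\<bar>-lipschitz_on UNIV g"
proof (rule lipschitz_on_bounded_subgradients)
  fix x
  interpret prob_space D using assms by (simp add: unbiased_subgradient_oracle_def)
  define v where "v = (\<integral>s. dg x s \<partial>D)"
  have dg: "integrable D (dg x)" "integrable D (\<lambda>s. (norm (dg x s))\<^sup>2)"
    "v \<in> subdifferential g x" "(\<integral>s. (norm (dg x s))\<^sup>2 \<partial>D) \<le> M\<^sup>2"
    using assms by (auto simp: unbiased_subgradient_oracle_def v_def)
  have "0 \<le> (\<integral>s. (norm (- v + 1 *\<^sub>R dg x s))\<^sup>2 \<partial>D)" by (intro integral_nonneg_AE) simp
  also have "\<dots> = (\<integral>s. (norm (dg x s))\<^sup>2 \<partial>D) - (norm v)\<^sup>2"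
    by (simp only: expectation_norm_sq_affine(2)[OF dg(1,2)])
       (simp add: v_def[symmetric] dot_square_norm)
  finally have "(norm v)\<^sup>2 \<le> M\<^sup>2" using dg(4) by simp
  then have "norm v \<le> \<bar>M\<bar>" by (simp add: abs_le_square_iff[symmetric])
  with dg(3) show "\<exists>v\<in>subdifferential g x. norm v \<le> \<bar>M\<bar>" by blast
qed simp

subsection \<open>The stochastic recursion\<close>

text \<open>The two oracles of an iteration need not be independent of each other; each one is only
  ever compared with the past.\<close>

locale momentum_run = moreau_dc g N \<gamma> h L + prob_space P
  for g :: "'a::euclidean_space \<Rightarrow> real" and N \<gamma> :: real and h :: "'a \<Rightarrow> real" and L :: real
    and P :: "'w measure" +
  fixes \<sigma> \<eta> \<eta>1 \<alpha> :: real and DH :: "'s measure" and DG :: "'u measure"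
    and dg :: "'a \<Rightarrow> 'u \<Rightarrow> 'a" and dh :: "'a \<Rightarrow> 's \<Rightarrow> 'a"
    and \<xi>h :: "nat \<Rightarrow> 'w \<Rightarrow> 's" and \<xi>g :: "nat \<Rightarrow> 'w \<Rightarrow> 'u"
    and x xg m :: "nat \<Rightarrow> 'w \<Rightarrow> 'a"
  assumes dg: "unbiased_subgradient_oracle g DG dg N"
    and dh: "unbiased_gradient_oracle h DH dh \<sigma>"
    and fresh: "fresh_samples P (x 0) (xg 0) DH \<xi>h DG \<xi>g"
    and run: "\<And>\<omega>. \<omega> \<in> space P \<Longrightarrow> single_loop_momentum \<gamma> \<eta> \<eta>1 (\<lambda>t. \<alpha>) dg dh
          (\<lambda>t. \<xi>g t \<omega>) (\<lambda>t. \<xi>h t \<omega>) (\<lambda>t. x t \<omega>) (\<lambda>t. xg t \<omega>) (\<lambda>t. m t \<omega>)"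
    and \<alpha>_eq: "\<alpha> = 2 * sqrt 2 * L * \<eta>" and \<eta>1_eq: "\<eta>1 = sqrt 32 * \<eta>" and \<eta>1_le: "\<eta>1 \<le> \<gamma>"
begin

lemma \<alpha>_pos: "0 < \<alpha>" and \<alpha>_le: "\<alpha> \<le> 1"
proof -
  \<comment> \<open>The constraints on \<alpha> are part of the description of a trajectory, so some
    sample point is required to read them off.\<close>
  obtain \<omega> where "\<omega> \<in> space P" using not_empty by blast
  from run[OF this] show "0 < \<alpha>" "\<alpha> \<le> 1" by (auto simp: single_loop_momentum_def)
qed

lemma \<eta>_pos: "0 < \<eta>" and \<eta>1_pos: "0 < \<eta>1"
proof -
  have "0 < 2 * sqrt 2 * L * \<eta>" using \<alpha>_pos unfolding \<alpha>_eq .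
  then show "0 < \<eta>" by (rule zero_less_mult_pos) (use L in simp)
  then show "0 < \<eta>1" by (simp add: \<eta>1_eq)
qed

lemma
  assumes "\<omega> \<in> space P"
  shows m_0: "m 0 \<omega> = dh (x 0 \<omega>) (\<xi>h 0 \<omega>)"
    and m_Suc: "m (Suc t) \<omega> = (1 - \<alpha>) *\<^sub>R m t \<omega> + \<alpha> *\<^sub>R dh (x (Suc t) \<omega>) (\<xi>h (Suc t) \<omega>)"
    and xg_Suc: "xg (Suc t) \<omega>
      = xg t \<omega> - \<eta>1 *\<^sub>R (dg (xg t \<omega>) (\<xi>g t \<omega>) + (xg t \<omega> - x t \<omega>) /\<^sub>R \<gamma>)"
    and x_Suc: "x (Suc t) \<omega> = x t \<omega> - \<eta> *\<^sub>R ((x t \<omega> - xg (Suc t) \<omega>) /\<^sub>R \<gamma> - m t \<omega>)"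
  using run[OF assms] by (auto simp: single_loop_momentum_def)

section \<open>Filtration of the past, and error recursions driven by fresh samples\<close>

definition "past_space t = borel \<Otimes>\<^sub>M borel \<Otimes>\<^sub>M (\<Pi>\<^sub>M s\<in>{..<t}. DH \<Otimes>\<^sub>M DG)"

definition "past_map t = (\<lambda>\<omega>. (x 0 \<omega>, xg 0 \<omega>, \<lambda>s\<in>{..<t}. (\<xi>h s \<omega>, \<xi>g s \<omega>)))"

text \<open>This and \<open>current\<close> copy the \<sigma>-algebras of
  \<open>fresh_samples\<close> literally, so that their independence follows by unfolding.\<close>

definition "past t = vimage_algebra (space P) (past_map t) (past_space t)"

definition "current t = vimage_algebra (space P) (\<lambda>\<omega>. (\<xi>h t \<omega>, \<xi>g t \<omega>)) (DH \<Otimes>\<^sub>M DG)"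

lemma space_past: "space (past t) = space P" and space_current: "space (current t) = space P"
  by (simp_all add: past_def current_def)

lemma indep_past_current: "indep_set (sets (past t)) (sets (current t))"
  using fresh by (simp add: fresh_samples_def past_def current_def past_map_def past_space_def)

lemma \<xi>h_P [measurable]: "\<xi>h t \<in> P \<rightarrow>\<^sub>M DH" and \<xi>g_P [measurable]: "\<xi>g t \<in> P \<rightarrow>\<^sub>M DG"
  and x0_P [measurable]: "x 0 \<in> borel_measurable P"
  and xg0_P [measurable]: "xg 0 \<in> borel_measurable P"
  and distr_\<xi>h: "distr P DH (\<xi>h t) = DH" and distr_\<xi>g: "distr P DG (\<xi>g t) = DG"
  using fresh by (auto simp: fresh_samples_def)

lemma \<xi>_current: "\<xi>h t \<in> current t \<rightarrow>\<^sub>M DH" "\<xi>g t \<in> current t \<rightarrow>\<^sub>M DG"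
proof -
  have "(\<lambda>\<omega>. (\<xi>h t \<omega>, \<xi>g t \<omega>)) \<in> P \<rightarrow>\<^sub>M DH \<Otimes>\<^sub>M DG" by measurable
  then have *: "(\<lambda>\<omega>. (\<xi>h t \<omega>, \<xi>g t \<omega>)) \<in> current t \<rightarrow>\<^sub>M DH \<Otimes>\<^sub>M DG"
    unfolding current_def by (intro measurable_vimage_algebra1) (auto simp: measurable_def)
  from measurable_compose[OF * measurable_fst] measurable_compose[OF * measurable_snd]
  show "\<xi>h t \<in> current t \<rightarrow>\<^sub>M DH" "\<xi>g t \<in> current t \<rightarrow>\<^sub>M DG" by simp_all
qed

lemma past_map_past: "past_map t \<in> past t \<rightarrow>\<^sub>M past_space t"
proof -
  have "past_map t \<in> P \<rightarrow>\<^sub>M past_space t" unfolding past_map_def past_space_def by measurable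
  then show ?thesis
    unfolding past_def by (intro measurable_vimage_algebra1) (auto simp: measurable_def)
qed

lemma x0_past: "x 0 \<in> past t \<rightarrow>\<^sub>M borel" and xg0_past: "xg 0 \<in> past t \<rightarrow>\<^sub>M borel"
  and \<xi>_past: "s < t \<Longrightarrow> (\<lambda>\<omega>. (\<xi>h s \<omega>, \<xi>g s \<omega>)) \<in> past t \<rightarrow>\<^sub>M DH \<Otimes>\<^sub>M DG"
proof -
  note 1 = past_map_past[of t, unfolded past_space_def]
  show "x 0 \<in> past t \<rightarrow>\<^sub>M borel"
    using measurable_compose[OF 1 measurable_fst] by (simp add: past_map_def)
  note 2 = measurable_compose[OF 1 measurable_snd]
  show "xg 0 \<in> past t \<rightarrow>\<^sub>M borel"
    using measurable_compose[OF 2 measurable_fst] by (simp add: past_map_def)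
  note 3 = measurable_compose[OF 2 measurable_snd]
  show "(\<lambda>\<omega>. (\<xi>h s \<omega>, \<xi>g s \<omega>)) \<in> past t \<rightarrow>\<^sub>M DH \<Otimes>\<^sub>M DG" if "s < t"
    using measurable_compose[OF 3 measurable_component_singleton[of s]] that
    by (simp add: past_map_def)
qed

lemma \<xi>h_past: "s < t \<Longrightarrow> \<xi>h s \<in> past t \<rightarrow>\<^sub>M DH" and \<xi>g_past: "s < t \<Longrightarrow> \<xi>g s \<in> past t \<rightarrow>\<^sub>M DG"
  using measurable_compose[OF \<xi>_past measurable_fst] measurable_compose[OF \<xi>_past measurable_snd]
  by simp_all

text \<open>\<open>past t\<close> is the smallest \<sigma>-algebra making \<open>past_map t\<close>
  measurable, and \<open>past (Suc t)\<close> already does so.\<close>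

lemma past_mono: "Z \<in> past t \<rightarrow>\<^sub>M S \<Longrightarrow> Z \<in> past (Suc t) \<rightarrow>\<^sub>M S"
proof -
  have "past_map t \<in> past (Suc t) \<rightarrow>\<^sub>M past_space t"
    unfolding past_map_def past_space_def
    by (intro measurable_Pair x0_past xg0_past measurable_restrict \<xi>h_past \<xi>g_past) auto
  then have "sets (past t) \<subseteq> sets (past (Suc t))"
    unfolding past_def[of t] by (intro sets_image_in_sets) (simp_all add: space_past)
  then show "Z \<in> past t \<rightarrow>\<^sub>M S \<Longrightarrow> Z \<in> past (Suc t) \<rightarrow>\<^sub>M S"
    by (auto simp: measurable_def space_past)
qed

lemma past_P: "Z \<in> past t \<rightarrow>\<^sub>M S \<Longrightarrow> Z \<in> P \<rightarrow>\<^sub>M S"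
  using indep_setD_ev1[OF indep_past_current[of t]] by (auto simp: measurable_def space_past)

lemma dg_measurable: "(\<lambda>(x, s). dg x s) \<in> borel_measurable (borel \<Otimes>\<^sub>M DG)"
  and dh_measurable: "(\<lambda>(x, s). dh x s) \<in> borel_measurable (borel \<Otimes>\<^sub>M DH)"
  using dg dh by (auto simp: unbiased_subgradient_oracle_def unbiased_gradient_oracle_def)

lemma dg_compose:
  assumes "X \<in> A \<rightarrow>\<^sub>M borel" "Y \<in> A \<rightarrow>\<^sub>M DG"
  shows "(\<lambda>\<omega>. dg (X \<omega>) (Y \<omega>)) \<in> A \<rightarrow>\<^sub>M borel"
  using measurable_compose[OF measurable_Pair[OF assms] dg_measurable] by simp

lemma dh_compose:
  assumes "X \<in> A \<rightarrow>\<^sub>M borel" "Y \<in> A \<rightarrow>\<^sub>M DH"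
  shows "(\<lambda>\<omega>. dh (X \<omega>) (Y \<omega>)) \<in> A \<rightarrow>\<^sub>M borel"
  using measurable_compose[OF measurable_Pair[OF assms] dh_measurable] by simp

text \<open>The index shift matters: x_t and x^g_t depend on samples before time t only, whereas m_t
  and x^g_{t+1} have consumed those of time t. The last conjunct is carried along because x_{t+1} is
  computed from x^g_{t+1}.\<close>

lemma adapted:
  "x t \<in> past t \<rightarrow>\<^sub>M borel \<and> xg t \<in> past t \<rightarrow>\<^sub>M borel \<and> m t \<in> past (Suc t) \<rightarrow>\<^sub>M borel
    \<and> xg (Suc t) \<in> past (Suc t) \<rightarrow>\<^sub>M borel"
proof -
  have xg_step: "xg (Suc t) \<in> past (Suc t) \<rightarrow>\<^sub>M borel"
    if "x t \<in> past t \<rightarrow>\<^sub>M borel" "xg t \<in> past t \<rightarrow>\<^sub>M borel" for t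
  proof -
    have [measurable]: "x t \<in> past (Suc t) \<rightarrow>\<^sub>M borel" "xg t \<in> past (Suc t) \<rightarrow>\<^sub>M borel"
      using that by (auto intro: past_mono)
    have [measurable]: "(\<lambda>\<omega>. dg (xg t \<omega>) (\<xi>g t \<omega>)) \<in> past (Suc t) \<rightarrow>\<^sub>M borel"
      by (intro dg_compose \<xi>g_past) auto
    show ?thesis
      by (subst measurable_cong[OF xg_Suc]) (simp add: space_past, measurable)
  qed
  show ?thesis
  proof (induction t)
    case 0
    have "(\<lambda>\<omega>. dh (x 0 \<omega>) (\<xi>h 0 \<omega>)) \<in> past (Suc 0) \<rightarrow>\<^sub>M borel"
      by (intro dh_compose \<xi>h_past x0_past) auto
    then have "m 0 \<in> past (Suc 0) \<rightarrow>\<^sub>M borel"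
      by (subst measurable_cong[OF m_0]) (simp_all add: space_past)
    then show ?case using xg_step x0_past xg0_past by blast
  next
    case (Suc t)
    note [measurable] = Suc[THEN conjunct1, THEN past_mono] Suc[THEN conjunct2, THEN conjunct2, THEN conjunct1]
      Suc[THEN conjunct2, THEN conjunct2, THEN conjunct2]
    have x: "x (Suc t) \<in> past (Suc t) \<rightarrow>\<^sub>M borel"
      by (subst measurable_cong[OF x_Suc]) (simp add: space_past, measurable)
    have [measurable]: "(\<lambda>\<omega>. dh (x (Suc t) \<omega>) (\<xi>h (Suc t) \<omega>)) \<in> past (Suc (Suc t)) \<rightarrow>\<^sub>M borel"
      by (intro dh_compose \<xi>h_past past_mono[OF x]) auto
    have [measurable]: "m t \<in> past (Suc (Suc t)) \<rightarrow>\<^sub>M borel"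
      using Suc by (blast intro: past_mono)
    have "m (Suc t) \<in> past (Suc (Suc t)) \<rightarrow>\<^sub>M borel"
      by (subst measurable_cong[OF m_Suc]) (simp add: space_past, measurable)
    then show ?case using x Suc xg_step by blast
  qed
qed

lemma x_past: "x t \<in> past t \<rightarrow>\<^sub>M borel" and xg_past: "xg t \<in> past t \<rightarrow>\<^sub>M borel"
  and m_past: "m t \<in> past (Suc t) \<rightarrow>\<^sub>M borel"
  using adapted by blast+

lemma x_P [measurable]: "x t \<in> borel_measurable P" and xg_P [measurable]: "xg t \<in> borel_measurable P"
  and m_P [measurable]: "m t \<in> borel_measurable P"
  using x_past xg_past m_past past_P by blast+

lemma prox_borel [measurable]: "prox \<gamma> g \<in> borel_measurable borel"
  and grad_h_borel [measurable]: "grad h \<in> borel_measurable borel"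
  and f_borel [measurable]: "f \<in> borel_measurable borel"
  using continuous_on_prox continuous_on_grad_h continuous_on_f
  by (auto intro: borel_measurable_continuous_onI)

lemma grad_f_borel [measurable]: "grad f \<in> borel_measurable borel"
  unfolding grad_f[abs_def] by measurable

text \<open>Given the past of time t + 1, both m_t and x_{t+1} are frozen and the new gradient noise
  is centred, so the cross term vanishes. The old error is measured against the new gradient;
  \<open>lyapunov_step\<close> accounts for this drift.\<close>

lemma momentum_error_step:
  assumes int: "integrable P (\<lambda>\<omega>. (norm (m t \<omega> - grad h (x (Suc t) \<omega>)))\<^sup>2)"
  shows "integrable P (\<lambda>\<omega>. (norm (m (Suc t) \<omega> - grad h (x (Suc t) \<omega>)))\<^sup>2)"
    and "(\<integral>\<omega>. (norm (m (Suc t) \<omega> - grad h (x (Suc t) \<omega>)))\<^sup>2 \<partial>P)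
      \<le> (1 - \<alpha>)\<^sup>2 * (\<integral>\<omega>. (norm (m t \<omega> - grad h (x (Suc t) \<omega>)))\<^sup>2 \<partial>P) + \<alpha>\<^sup>2 * \<sigma>\<^sup>2"
proof -
  define \<phi> where "\<phi> = (\<lambda>((z::'a, w::'a), s). (norm ((1 - \<alpha>) *\<^sub>R (w - grad h z) + \<alpha> *\<^sub>R (dh z s - grad h z)))\<^sup>2)"
  define \<psi> where "\<psi> = (\<lambda>(z::'a, w::'a). (1 - \<alpha>)\<^sup>2 * (norm (w - grad h z))\<^sup>2 + \<alpha>\<^sup>2 * \<sigma>\<^sup>2)"
  let ?X = "\<lambda>\<omega>. (x (Suc t) \<omega>, m t \<omega>)"
  note ind = indep_set_joint_distr[OF indep_past_current space_past space_current
      measurable_Pair[OF x_past m_past] \<xi>_current(1)]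
  interpret DH: prob_space DH using dh by (simp add: unbiased_gradient_oracle_def)
  have [measurable]: "(\<lambda>z. dh (fst (fst z)) (snd z)) \<in> borel_measurable ((borel \<Otimes>\<^sub>M borel) \<Otimes>\<^sub>M DH)"
    by (intro dh_compose) measurable
  have \<phi>_meas: "\<phi> \<in> borel_measurable ((borel \<Otimes>\<^sub>M borel) \<Otimes>\<^sub>M DH)"
    unfolding \<phi>_def case_prod_beta by measurable
  have \<phi>_nonneg: "0 \<le> \<phi> z" for z by (simp add: \<phi>_def case_prod_beta)
  have \<phi>_int: "integrable DH (\<lambda>s. \<phi> (a, s))" and \<phi>_le: "(\<integral>s. \<phi> (a, s) \<partial>DH) \<le> \<psi> a" for a
  proof -
    obtain z w where a: "a = (z, w)" by (cases a)
    have o: "integrable DH (dh z)" "(\<integral>s. dh z s \<partial>DH) = grad h z"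
       "integrable DH (\<lambda>s. (norm (dh z s - grad h z))\<^sup>2)"
       "(\<integral>s. (norm (dh z s - grad h z))\<^sup>2 \<partial>DH) \<le> \<sigma>\<^sup>2"
      using dh by (auto simp: unbiased_gradient_oracle_def)
    have Z: "integrable DH (\<lambda>s. dh z s - grad h z)" "(\<integral>s. dh z s - grad h z \<partial>DH) = 0"
      using o by (simp_all add: DH.prob_space)
    show "integrable DH (\<lambda>s. \<phi> (a, s))"
      unfolding a \<phi>_def prod.case by (rule DH.expectation_norm_sq_affine[OF Z(1) o(3)])
    have "(\<integral>s. \<phi> (a, s) \<partial>DH) = (norm ((1 - \<alpha>) *\<^sub>R (w - grad h z)))\<^sup>2
        + \<alpha>\<^sup>2 * (\<integral>s. (norm (dh z s - grad h z))\<^sup>2 \<partial>DH)"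
      unfolding a \<phi>_def prod.case DH.expectation_norm_sq_affine(2)[OF Z(1) o(3)] Z(2) by simp
    also have "\<dots> \<le> (norm ((1 - \<alpha>) *\<^sub>R (w - grad h z)))\<^sup>2 + \<alpha>\<^sup>2 * \<sigma>\<^sup>2"
      using o(4) by (intro add_left_mono mult_left_mono) auto
    finally show "(\<integral>s. \<phi> (a, s) \<partial>DH) \<le> \<psi> a"
      by (simp add: a \<psi>_def power_mult_distrib)
  qed
  have \<psi>_int: "integrable P (\<lambda>\<omega>. \<psi> (?X \<omega>))" unfolding \<psi>_def using int by simp
  have eq: "(norm (m (Suc t) \<omega> - grad h (x (Suc t) \<omega>)))\<^sup>2 = \<phi> (?X \<omega>, \<xi>h (Suc t) \<omega>)"
    if "\<omega> \<in> space P" for \<omega>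
    unfolding \<phi>_def prod.case m_Suc[OF that]
    by (rule arg_cong[where f = "\<lambda>z. (norm z)\<^sup>2"]) (simp add: algebra_simps)
  note * = expectation_indep_le[OF ind distr_\<xi>h \<phi>_meas \<phi>_nonneg \<phi>_int \<phi>_le \<psi>_int]
  show "integrable P (\<lambda>\<omega>. (norm (m (Suc t) \<omega> - grad h (x (Suc t) \<omega>)))\<^sup>2)"
    by (subst Bochner_Integration.integrable_cong[OF refl eq]) (auto intro: *(1))
  have "(\<integral>\<omega>. (norm (m (Suc t) \<omega> - grad h (x (Suc t) \<omega>)))\<^sup>2 \<partial>P) \<le> (\<integral>\<omega>. \<psi> (?X \<omega>) \<partial>P)"
    using *(2) by (subst Bochner_Integration.integral_cong[OF refl eq]) auto
  also have "\<dots> = (1 - \<alpha>)\<^sup>2 * (\<integral>\<omega>. (norm (m t \<omega> - grad h (x (Suc t) \<omega>)))\<^sup>2 \<partial>P) + \<alpha>\<^sup>2 * \<sigma>\<^sup>2"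
    unfolding \<psi>_def using int by (simp add: prob_space)
  finally show "(\<integral>\<omega>. (norm (m (Suc t) \<omega> - grad h (x (Suc t) \<omega>)))\<^sup>2 \<partial>P)
      \<le> (1 - \<alpha>)\<^sup>2 * (\<integral>\<omega>. (norm (m t \<omega> - grad h (x (Suc t) \<omega>)))\<^sup>2 \<partial>P) + \<alpha>\<^sup>2 * \<sigma>\<^sup>2" .
qed

text \<open>The proximal point is stationary for the exact update, as \<open>S z\<close> is a
  subgradient of \<open>g\<close> there. Subtracting it leaves a contraction plus \<eta>1 times the
  difference of \<open>dg\<close> and \<open>S z\<close>; the mean of the cross term has the right
  sign by monotonicity of the subdifferential.\<close>

lemma prox_error_step:
  assumes int: "integrable P (\<lambda>\<omega>. (norm (xg t \<omega> - prox \<gamma> g (x t \<omega>)))\<^sup>2)"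
  shows "integrable P (\<lambda>\<omega>. (norm (xg (Suc t) \<omega> - prox \<gamma> g (x t \<omega>)))\<^sup>2)"
    and "(\<integral>\<omega>. (norm (xg (Suc t) \<omega> - prox \<gamma> g (x t \<omega>)))\<^sup>2 \<partial>P)
      \<le> (1 - \<eta>1 / \<gamma>)\<^sup>2 * (\<integral>\<omega>. (norm (xg t \<omega> - prox \<gamma> g (x t \<omega>)))\<^sup>2 \<partial>P) + 4 * \<eta>1\<^sup>2 * N\<^sup>2"
proof -
  define S where "S = (\<lambda>z. (z - prox \<gamma> g z) /\<^sub>R \<gamma>)"
  define b where "b = 1 - \<eta>1 / \<gamma>"
  \<comment> \<open>The condition \<eta>1 \<le> \<gamma> enters here: a negative factor would
    reverse the sign of the cross term.\<close>
  have b: "0 \<le> b" using \<eta>1_le \<gamma> by (simp add: b_def)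
  define \<phi> where "\<phi> = (\<lambda>((z::'a, y::'a), s). (norm (b *\<^sub>R (y - prox \<gamma> g z) + (- \<eta>1) *\<^sub>R (dg y s - S z)))\<^sup>2)"
  define \<psi> where "\<psi> = (\<lambda>(z::'a, y::'a). b\<^sup>2 * (norm (y - prox \<gamma> g z))\<^sup>2 + 4 * \<eta>1\<^sup>2 * N\<^sup>2)"
  let ?X = "\<lambda>\<omega>. (x t \<omega>, xg t \<omega>)"
  note ind = indep_set_joint_distr[OF indep_past_current space_past space_current
      measurable_Pair[OF x_past xg_past] \<xi>_current(2)]
  interpret DG: prob_space DG using dg by (simp add: unbiased_subgradient_oracle_def)
  have [measurable]: "(\<lambda>z. dg (snd (fst z)) (snd z)) \<in> borel_measurable ((borel \<Otimes>\<^sub>M borel) \<Otimes>\<^sub>M DG)"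
    by (intro dg_compose) measurable
  have [measurable]: "S \<in> borel_measurable borel" unfolding S_def by measurable
  have \<phi>_meas: "\<phi> \<in> borel_measurable ((borel \<Otimes>\<^sub>M borel) \<Otimes>\<^sub>M DG)"
    unfolding \<phi>_def case_prod_beta by measurable
  have \<phi>_nonneg: "0 \<le> \<phi> z" for z by (simp add: \<phi>_def case_prod_beta)
  have \<phi>_int: "integrable DG (\<lambda>s. \<phi> (a, s))" and \<phi>_le: "(\<integral>s. \<phi> (a, s) \<partial>DG) \<le> \<psi> a" for a
  proof -
    obtain z y where a: "a = (z, y)" by (cases a)
    define v where "v = (\<integral>s. dg y s \<partial>DG)"
    have o: "integrable DG (dg y)" "v \<in> subdifferential g y"
       "integrable DG (\<lambda>s. (norm (dg y s))\<^sup>2)" "(\<integral>s. (norm (dg y s))\<^sup>2 \<partial>DG) \<le> N\<^sup>2"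
      using dg by (auto simp: unbiased_subgradient_oracle_def v_def)
    have Z: "integrable DG (\<lambda>s. dg y s - S z)" "(\<integral>s. dg y s - S z \<partial>DG) = v - S z"
      using o by (simp_all add: DG.prob_space v_def)
    have Z2: "integrable DG (\<lambda>s. (norm (dg y s - S z))\<^sup>2)"
      using DG.expectation_norm_sq_affine(1)[OF o(1,3), of "- S z" 1] by simp
    \<comment> \<open>Both the oracle and \<open>S z\<close> have second moment at most N^2, whence
      2 + 2 = 4.\<close>
    have "(\<integral>s. (norm (dg y s - S z))\<^sup>2 \<partial>DG) \<le> (\<integral>s. 2 * (norm (dg y s))\<^sup>2 + 2 * N\<^sup>2 \<partial>DG)"
    proof (rule integral_mono[OF Z2])
      fix s
      have "(norm (S z))\<^sup>2 \<le> N\<^sup>2"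
        unfolding S_def by (intro power_mono prox_dist_le norm_ge_zero)
      then show "(norm (dg y s - S z))\<^sup>2 \<le> 2 * (norm (dg y s))\<^sup>2 + 2 * N\<^sup>2"
        using norm_add_sq_le[of "dg y s" "- S z"] by simp
    qed (use o in simp)
    also have "\<dots> \<le> 4 * N\<^sup>2" using o by (simp add: DG.prob_space)
    finally have var: "(\<integral>s. (norm (dg y s - S z))\<^sup>2 \<partial>DG) \<le> 4 * N\<^sup>2" .
    show "integrable DG (\<lambda>s. \<phi> (a, s))"
      unfolding a \<phi>_def prod.case by (rule DG.expectation_norm_sq_affine[OF Z(1) Z2])
    have "0 \<le> (v - S z) \<bullet> (y - prox \<gamma> g z)"
      unfolding S_def by (rule subdifferential_monotone[OF o(2) prox_subgradient])
    then have mono: "0 \<le> \<eta>1 * (b * ((y - prox \<gamma> g z) \<bullet> (v - S z)))"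
      using b \<eta>1_pos by (simp add: inner_commute)
    have "(\<integral>s. \<phi> (a, s) \<partial>DG) = b\<^sup>2 * (norm (y - prox \<gamma> g z))\<^sup>2
        - 2 * (\<eta>1 * (b * ((y - prox \<gamma> g z) \<bullet> (v - S z))))
        + \<eta>1\<^sup>2 * (\<integral>s. (norm (dg y s - S z))\<^sup>2 \<partial>DG)"
      unfolding a \<phi>_def prod.case DG.expectation_norm_sq_affine(2)[OF Z(1) Z2] Z(2)
      by (simp add: power_mult_distrib)
    also have "\<dots> \<le> b\<^sup>2 * (norm (y - prox \<gamma> g z))\<^sup>2 + \<eta>1\<^sup>2 * (4 * N\<^sup>2)"
      using mult_left_mono[OF var, of "\<eta>1\<^sup>2"] mono by simp
    finally show "(\<integral>s. \<phi> (a, s) \<partial>DG) \<le> \<psi> a"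
      by (simp add: a \<psi>_def)
  qed
  have \<psi>_int: "integrable P (\<lambda>\<omega>. \<psi> (?X \<omega>))" unfolding \<psi>_def using int by simp
  have eq: "(norm (xg (Suc t) \<omega> - prox \<gamma> g (x t \<omega>)))\<^sup>2 = \<phi> (?X \<omega>, \<xi>g t \<omega>)"
    if "\<omega> \<in> space P" for \<omega>
    unfolding \<phi>_def prod.case xg_Suc[OF that] S_def b_def
    by (rule arg_cong[where f = "\<lambda>z. (norm z)\<^sup>2"]) (simp add: algebra_simps divide_inverse)
  note * = expectation_indep_le[OF ind distr_\<xi>g \<phi>_meas \<phi>_nonneg \<phi>_int \<phi>_le \<psi>_int]
  show "integrable P (\<lambda>\<omega>. (norm (xg (Suc t) \<omega> - prox \<gamma> g (x t \<omega>)))\<^sup>2)"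
    by (subst Bochner_Integration.integrable_cong[OF refl eq]) (auto intro: *(1))
  have "(\<integral>\<omega>. (norm (xg (Suc t) \<omega> - prox \<gamma> g (x t \<omega>)))\<^sup>2 \<partial>P) \<le> (\<integral>\<omega>. \<psi> (?X \<omega>) \<partial>P)"
    using *(2) by (subst Bochner_Integration.integral_cong[OF refl eq]) auto
  also have "\<dots> = b\<^sup>2 * (\<integral>\<omega>. (norm (xg t \<omega> - prox \<gamma> g (x t \<omega>)))\<^sup>2 \<partial>P) + 4 * \<eta>1\<^sup>2 * N\<^sup>2"
    unfolding \<psi>_def using int by (simp add: prob_space)
  finally show "(\<integral>\<omega>. (norm (xg (Suc t) \<omega> - prox \<gamma> g (x t \<omega>)))\<^sup>2 \<partial>P)
      \<le> (1 - \<eta>1 / \<gamma>)\<^sup>2 * (\<integral>\<omega>. (norm (xg t \<omega> - prox \<gamma> g (x t \<omega>)))\<^sup>2 \<partial>P) + 4 * \<eta>1\<^sup>2 * N\<^sup>2"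
    by (simp add: b_def)
qed

end

section \<open>Descent of the Lyapunov function in expectation\<close>

context momentum_run
begin

definition "gap t = (\<lambda>\<omega>. f (x t \<omega>) - f_inf)"

text \<open>The indices are staggered, pairing x^g_{t+1} with x_t, since the update of
  \<open>x\<close> uses the fresh proximal iterate; at time 0 this is the term in the initial
  potential.\<close>

definition "prox_err t = (\<lambda>\<omega>. (norm (xg (Suc t) \<omega> - prox \<gamma> g (x t \<omega>)))\<^sup>2)"

definition "mom_err t = (\<lambda>\<omega>. (norm (m t \<omega> - grad h (x t \<omega>)))\<^sup>2)"

definition "grad_sq t = (\<lambda>\<omega>. (norm (grad f (x t \<omega>)))\<^sup>2)"

definition "integrable_state t \<longleftrightarrow>
  integrable P (gap t) \<and> integrable P (prox_err t) \<and> integrable P (mom_err t)"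

text \<open>The weights turn the contraction rates \<eta>1 / \<gamma> and \<alpha> into gains \<eta>
  / \<gamma>^2 and \<eta>, which are the coefficients of the bias in the descent of
  \<open>f\<close>.\<close>

definition "lyapunov t = (\<integral>\<omega>. gap t \<omega> \<partial>P)
  + \<eta> / (\<gamma> * \<eta>1) * (\<integral>\<omega>. prox_err t \<omega> \<partial>P) + \<eta> / \<alpha> * (\<integral>\<omega>. mom_err t \<omega> \<partial>P)"

lemma integrable_grad_sq: "integrable P (grad_sq t)"
proof (rule integrable_const_bound[where B = "(2 * N)\<^sup>2"])
  have "norm (grad_sq t \<omega>) \<le> (2 * N)\<^sup>2" for \<omega>
    using power_mono[OF norm_grad_f_le norm_ge_zero, of "x t \<omega>" 2] by (simp add: grad_sq_def)
  then show "AE \<omega> in P. norm (grad_sq t \<omega>) \<le> (2 * N)\<^sup>2" by simp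
qed (simp add: grad_sq_def)

text \<open>The pointwise inequality \<open>lyapunov_step\<close> is integrated and the two error
  recursions add their noise. Integrability is propagated as well, because for the state it is given
  at time 0 only.\<close>

lemma expected_descent:
  assumes "integrable_state t"
  shows "integrable_state (Suc t)"
    and "lyapunov (Suc t) + \<eta> / 2 * (\<integral>\<omega>. grad_sq t \<omega> \<partial>P)
      \<le> lyapunov t + 24 * \<eta>\<^sup>2 * (L * \<sigma>\<^sup>2 + N\<^sup>2 / \<gamma>)"
proof -
  define c1 c2 where "c1 = \<eta> / (\<gamma> * \<eta>1)" and "c2 = \<eta> / \<alpha>"
  have c: "0 < c1" "0 < c2" using \<eta>_pos \<eta>1_pos \<alpha>_pos \<gamma> by (simp_all add: c1_def c2_def)
  \<comment> \<open>\<open>q\<close> and \<open>r\<close> are intermediate errors: the target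
    already belongs to x_{t+1}, while x^g_{t+1} and m_t have not yet been refreshed.\<close>
  define q where "q = (\<lambda>\<omega>. (norm (xg (Suc t) \<omega> - prox \<gamma> g (x (Suc t) \<omega>)))\<^sup>2)"
  define r where "r = (\<lambda>\<omega>. (norm (m t \<omega> - grad h (x (Suc t) \<omega>)))\<^sup>2)"
  define bq br where "bq = (1 - \<eta>1 / \<gamma>)\<^sup>2" and "br = (1 - \<alpha>)\<^sup>2"
  define U where "U = (\<lambda>\<omega>. gap t \<omega> + c1 * prox_err t \<omega> + c2 * mom_err t \<omega> - \<eta> / 2 * grad_sq t \<omega>)"
  note st = assms[unfolded integrable_state_def]
  have U: "integrable P U" unfolding U_def using st integrable_grad_sq by simp
  have step: "gap (Suc t) \<omega> + c1 * (bq * q \<omega>) + c2 * (br * r \<omega>) \<le> U \<omega>"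
    if "\<omega> \<in> space P" for \<omega>
    using lyapunov_step[OF \<eta>_pos \<eta>1_eq \<eta>1_le \<alpha>_eq \<alpha>_le x_Suc[OF that, of t]]
    unfolding gap_def prox_err_def mom_err_def grad_sq_def U_def q_def r_def c1_def c2_def bq_def br_def
    by linarith
  have nn: "0 \<le> gap (Suc t) \<omega>" "0 \<le> c1 * (bq * q \<omega>)" "0 \<le> c2 * (br * r \<omega>)" for \<omega>
    using f_inf_le c by (auto simp: gap_def q_def r_def bq_def br_def)
  have [measurable]: "gap (Suc t) \<in> borel_measurable P" "q \<in> borel_measurable P" "r \<in> borel_measurable P"
    unfolding gap_def q_def r_def by measurable
  have "norm (gap (Suc t) \<omega>) \<le> norm (U \<omega>)" if "\<omega> \<in> space P" for \<omega>
    using step[OF that] nn[of \<omega>] unfolding real_norm_def by linarith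
  then have gap': "integrable P (gap (Suc t))"
    by (intro Bochner_Integration.integrable_bound[OF U] AE_I2) auto
  \<comment> \<open>Domination by \<open>U\<close> says nothing about \<open>q\<close> or
    \<open>r\<close> when \<eta>1 = \<gamma> or \<alpha> = 1, since their factors vanish. Their
    integrability comes instead from that of the squared displacement, which is \<eta> times the
    gradient plus the two errors.\<close>
  have step_int: "integrable P (\<lambda>\<omega>. (norm (x t \<omega> - x (Suc t) \<omega>))\<^sup>2)"
  proof (rule Bochner_Integration.integrable_bound)
    show "integrable P (\<lambda>\<omega>. \<eta>\<^sup>2 * (2 * grad_sq t \<omega> + 2 * (2 / \<gamma>\<^sup>2 * prox_err t \<omega> + 2 * mom_err t \<omega>)))"
      using st integrable_grad_sq by simp
    show "AE \<omega> in P. norm ((norm (x t \<omega> - x (Suc t) \<omega>))\<^sup>2)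
      \<le> norm (\<eta>\<^sup>2 * (2 * grad_sq t \<omega> + 2 * (2 / \<gamma>\<^sup>2 * prox_err t \<omega> + 2 * mom_err t \<omega>)))"
    proof (rule AE_I2)
      fix \<omega> assume \<omega>: "\<omega> \<in> space P"
      let ?D = "xg (Suc t) \<omega> - prox \<gamma> g (x t \<omega>)" and ?\<Delta> = "m t \<omega> - grad h (x t \<omega>)"
      have "x t \<omega> - x (Suc t) \<omega> = \<eta> *\<^sub>R (grad f (x t \<omega>) + ((- 1 / \<gamma>) *\<^sub>R ?D + - ?\<Delta>))"
        unfolding x_Suc[OF \<omega>] grad_f by (simp add: algebra_simps divide_inverse)
      then have "(norm (x t \<omega> - x (Suc t) \<omega>))\<^sup>2
          = \<eta>\<^sup>2 * (norm (grad f (x t \<omega>) + ((- 1 / \<gamma>) *\<^sub>R ?D + - ?\<Delta>)))\<^sup>2"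
        by (simp only: norm_scaleR power_mult_distrib power2_abs)
      also have "\<dots> \<le> \<eta>\<^sup>2 * (2 * grad_sq t \<omega> + 2 * (2 / \<gamma>\<^sup>2 * prox_err t \<omega> + 2 * mom_err t \<omega>))"
      proof (rule mult_left_mono)
        have "(norm ((- 1 / \<gamma>) *\<^sub>R ?D + - ?\<Delta>))\<^sup>2 \<le> 2 / \<gamma>\<^sup>2 * prox_err t \<omega> + 2 * mom_err t \<omega>"
          using norm_add_sq_le[of "(- 1 / \<gamma>) *\<^sub>R ?D" "- ?\<Delta>"]
          by (simp add: prox_err_def mom_err_def power_mult_distrib power_divide
              norm_minus_commute[of "grad h (x t \<omega>)"])
        then show "(norm (grad f (x t \<omega>) + ((- 1 / \<gamma>) *\<^sub>R ?D + - ?\<Delta>)))\<^sup>2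
            \<le> 2 * grad_sq t \<omega> + 2 * (2 / \<gamma>\<^sup>2 * prox_err t \<omega> + 2 * mom_err t \<omega>)"
          unfolding grad_sq_def
          by - (rule order_trans[OF norm_add_sq_le], intro add_left_mono mult_left_mono, assumption, simp)
      qed simp
      finally show "norm ((norm (x t \<omega> - x (Suc t) \<omega>))\<^sup>2)
        \<le> norm (\<eta>\<^sup>2 * (2 * grad_sq t \<omega> + 2 * (2 / \<gamma>\<^sup>2 * prox_err t \<omega> + 2 * mom_err t \<omega>)))"
        by simp
    qed
  qed measurable
  have qi: "integrable P q"
  proof (rule Bochner_Integration.integrable_bound)
    show "integrable P (\<lambda>\<omega>. 2 * prox_err t \<omega> + 2 * (norm (x t \<omega> - x (Suc t) \<omega>))\<^sup>2)"
      using st step_int by simp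
    have "q \<omega> \<le> 2 * prox_err t \<omega> + 2 * (norm (x t \<omega> - x (Suc t) \<omega>))\<^sup>2" for \<omega>
    proof -
      have "q \<omega> \<le> 2 * prox_err t \<omega> + 2 * (norm (prox \<gamma> g (x t \<omega>) - prox \<gamma> g (x (Suc t) \<omega>)))\<^sup>2"
        using norm_add_sq_le[of "xg (Suc t) \<omega> - prox \<gamma> g (x t \<omega>)"
            "prox \<gamma> g (x t \<omega>) - prox \<gamma> g (x (Suc t) \<omega>)"]
        by (simp add: q_def prox_err_def)
      then show ?thesis
        using power_mono[OF prox_nonexpansive[of "x t \<omega>" "x (Suc t) \<omega>"] norm_ge_zero, of 2]
        by linarith
    qed
    then show "AE \<omega> in P. norm (q \<omega>) \<le> norm (2 * prox_err t \<omega> + 2 * (norm (x t \<omega> - x (Suc t) \<omega>))\<^sup>2)"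
      by (intro AE_I2) (simp add: q_def prox_err_def)
  qed measurable
  have ri: "integrable P r"
  proof (rule Bochner_Integration.integrable_bound)
    show "integrable P (\<lambda>\<omega>. 2 * mom_err t \<omega> + 2 * (L\<^sup>2 * (norm (x t \<omega> - x (Suc t) \<omega>))\<^sup>2))"
      using st step_int by simp
    have "r \<omega> \<le> 2 * mom_err t \<omega> + 2 * (L\<^sup>2 * (norm (x t \<omega> - x (Suc t) \<omega>))\<^sup>2)" for \<omega>
    proof -
      have "r \<omega> \<le> 2 * mom_err t \<omega> + 2 * (norm (grad h (x t \<omega>) - grad h (x (Suc t) \<omega>)))\<^sup>2"
        using norm_add_sq_le[of "m t \<omega> - grad h (x t \<omega>)" "grad h (x t \<omega>) - grad h (x (Suc t) \<omega>)"]
        by (simp add: r_def mom_err_def)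
      then show ?thesis
        using power_mono[OF grad_h_lipschitz[of "x t \<omega>" "x (Suc t) \<omega>"] norm_ge_zero, of 2]
        unfolding power_mult_distrib by linarith
    qed
    then show "AE \<omega> in P. norm (r \<omega>) \<le> norm (2 * mom_err t \<omega> + 2 * (L\<^sup>2 * (norm (x t \<omega> - x (Suc t) \<omega>))\<^sup>2))"
      by (intro AE_I2) (simp add: r_def mom_err_def)
  qed measurable
  note prox' = prox_error_step[of "Suc t", folded q_def prox_err_def bq_def, OF qi]
  note mom' = momentum_error_step[of t, folded r_def mom_err_def br_def, OF ri]
  show "integrable_state (Suc t)"
    unfolding integrable_state_def using gap' prox'(1) mom'(1) by simp
  have "(\<integral>\<omega>. gap (Suc t) \<omega> \<partial>P) + c1 * (bq * (\<integral>\<omega>. q \<omega> \<partial>P)) + c2 * (br * (\<integral>\<omega>. r \<omega> \<partial>P))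
      = (\<integral>\<omega>. gap (Suc t) \<omega> + c1 * (bq * q \<omega>) + c2 * (br * r \<omega>) \<partial>P)"
    using gap' qi ri by simp
  also have "\<dots> \<le> (\<integral>\<omega>. U \<omega> \<partial>P)"
    using gap' qi ri U step by (intro integral_mono) auto
  also have "\<dots> = lyapunov t - \<eta> / 2 * (\<integral>\<omega>. grad_sq t \<omega> \<partial>P)"
    unfolding U_def lyapunov_def c1_def c2_def using st integrable_grad_sq by simp
  finally have 1: "(\<integral>\<omega>. gap (Suc t) \<omega> \<partial>P) + c1 * (bq * (\<integral>\<omega>. q \<omega> \<partial>P)) + c2 * (br * (\<integral>\<omega>. r \<omega> \<partial>P))
      \<le> lyapunov t - \<eta> / 2 * (\<integral>\<omega>. grad_sq t \<omega> \<partial>P)" .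
  have 2: "c1 * (\<integral>\<omega>. prox_err (Suc t) \<omega> \<partial>P)
      \<le> c1 * (bq * (\<integral>\<omega>. q \<omega> \<partial>P)) + c1 * (4 * \<eta>1\<^sup>2 * N\<^sup>2)"
    using mult_left_mono[OF prox'(2), of c1] c by (simp add: distrib_left)
  have 3: "c2 * (\<integral>\<omega>. mom_err (Suc t) \<omega> \<partial>P)
      \<le> c2 * (br * (\<integral>\<omega>. r \<omega> \<partial>P)) + c2 * (\<alpha>\<^sup>2 * \<sigma>\<^sup>2)"
    using mult_left_mono[OF mom'(2), of c2] c by (simp add: distrib_left)
  \<comment> \<open>The noise constants are 4 sqrt 32 and 2 sqrt 2; sqrt 32 \<le> 6 and the crude
    sqrt 2 \<le> 12 bring both below 24.\<close>
  have "c1 * (4 * \<eta>1\<^sup>2 * N\<^sup>2) = (4 * sqrt 32) * (\<eta>\<^sup>2 * (N\<^sup>2 / \<gamma>))"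
    using \<eta>1_pos by (simp add: c1_def power2_eq_square) (simp add: \<eta>1_eq)
  also have "\<dots> \<le> 24 * (\<eta>\<^sup>2 * (N\<^sup>2 / \<gamma>))"
    using real_le_lsqrt[of 6 32] \<gamma> by (intro mult_right_mono) auto
  finally have 4: "c1 * (4 * \<eta>1\<^sup>2 * N\<^sup>2) \<le> 24 * (\<eta>\<^sup>2 * (N\<^sup>2 / \<gamma>))" .
  have "c2 * (\<alpha>\<^sup>2 * \<sigma>\<^sup>2) = (2 * sqrt 2) * (\<eta>\<^sup>2 * (L * \<sigma>\<^sup>2))"
    using \<alpha>_pos by (simp add: c2_def power2_eq_square) (simp add: \<alpha>_eq)
  also have "\<dots> \<le> 24 * (\<eta>\<^sup>2 * (L * \<sigma>\<^sup>2))"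
    using real_le_lsqrt[of 12 2] L by (intro mult_right_mono) auto
  finally have 5: "c2 * (\<alpha>\<^sup>2 * \<sigma>\<^sup>2) \<le> 24 * (\<eta>\<^sup>2 * (L * \<sigma>\<^sup>2))" .
  show "lyapunov (Suc t) + \<eta> / 2 * (\<integral>\<omega>. grad_sq t \<omega> \<partial>P)
      \<le> lyapunov t + 24 * \<eta>\<^sup>2 * (L * \<sigma>\<^sup>2 + N\<^sup>2 / \<gamma>)"
    using 1 2 3 4 5 unfolding lyapunov_def[of "Suc t"] c1_def[symmetric] c2_def[symmetric]
    by (simp add: algebra_simps)
qed

text \<open>The descent inequality telescopes, and the final Lyapunov value is dropped because it is
  nonnegative.\<close>

lemma sum_expectation_grad_sq_le:
  assumes "integrable_state 0"
  shows "\<eta> / 2 * (\<Sum>t<T. \<integral>\<omega>. grad_sq t \<omega> \<partial>P)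
    \<le> lyapunov 0 + real T * (24 * \<eta>\<^sup>2 * (L * \<sigma>\<^sup>2 + N\<^sup>2 / \<gamma>))"
proof -
  define K where "K = 24 * \<eta>\<^sup>2 * (L * \<sigma>\<^sup>2 + N\<^sup>2 / \<gamma>)"
  have "integrable_state T \<and> lyapunov T + \<eta> / 2 * (\<Sum>t<T. \<integral>\<omega>. grad_sq t \<omega> \<partial>P)
    \<le> lyapunov 0 + real T * K"
  proof (induction T)
    case (Suc T)
    then show ?case using expected_descent[of T, folded K_def]
      by (simp add: distrib_left distrib_right)
  qed (use assms in simp)
  moreover have "0 \<le> lyapunov T"
    unfolding lyapunov_def gap_def prox_err_def mom_err_def using \<eta>_pos \<eta>1_pos \<alpha>_pos \<gamma>
    by (intro add_nonneg_nonneg mult_nonneg_nonneg Bochner_Integration.integral_nonneg)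
       (auto simp: f_inf_le)
  ultimately show ?thesis unfolding K_def by simp
qed

end

subsection \<open>Choice of the step size\<close>

text \<open>The first bound keeps the accumulated noise below the initial potential; the second
  turns p / (T \<eta>) into the claimed rate by checking which entry attains the minimum. Taking
  \<open>p\<close> as a given number avoids any fixed-point argument, although the potential itself
  depends on the step size through x^g_1.\<close>

lemma stepsize_bound:
  fixes Lg Lh p n \<eta> T :: real
  assumes \<eta>: "\<eta> = capped_stepsize (1 / Lg) (1 / Lh) p (T * n)" and pos: "0 < \<eta>"
    and Lh: "0 < Lh" "Lh \<le> Lg" and p: "0 \<le> p" and n: "0 \<le> n" and T: "0 < T"
  shows "T * n * \<eta>\<^sup>2 \<le> p" and "p / (T * \<eta>) \<le> sqrt (n * p / T) + Lg * p / T"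
proof -
  let ?s = "sqrt (p / (T * n))"
  have cases: "\<eta> = 1 / Lg \<or> \<eta> = 1 / Lh \<or> n \<noteq> 0 \<and> \<eta> = ?s"
    unfolding \<eta> capped_stepsize_def using T by (auto simp: min_def)
  show "T * n * \<eta>\<^sup>2 \<le> p"
  proof (cases "n = 0")
    case False
    then have "\<eta> \<le> ?s" unfolding \<eta> capped_stepsize_def using T by auto
    then have "\<eta>\<^sup>2 \<le> ?s\<^sup>2" using pos by (intro power_mono) auto
    also have "\<dots> = p / (T * n)" using p n T by simp
    finally show ?thesis using False n T by (simp add: pos_le_divide_eq mult.commute)
  qed (use p in simp)
  have s_nonneg: "0 \<le> sqrt (n * p / T)" and l_nonneg: "0 \<le> Lg * p / T"
    using n p T Lh by auto
  from cases show "p / (T * \<eta>) \<le> sqrt (n * p / T) + Lg * p / T"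
  proof (elim disjE conjE)
    assume "\<eta> = 1 / Lg" then show ?thesis using s_nonneg by (simp add: mult.commute)
  next
    assume "\<eta> = 1 / Lh"
    then have "p / (T * \<eta>) = Lh * p / T" by (simp add: mult.commute)
    also have "\<dots> \<le> Lg * p / T" using Lh p T by (intro divide_right_mono mult_right_mono) auto
    finally show ?thesis using s_nonneg by linarith
  next
    assume n0: "n \<noteq> 0" and s: "\<eta> = ?s"
    have "p / (T * \<eta>) = sqrt (n * p / T)"
    proof (rule real_sqrt_unique[symmetric])
      \<comment> \<open>If \<open>p\<close> were 0, the square root and hence the step size would be
        0.\<close>
      have "0 < p" using s pos p n T by (cases "p = 0") auto
      moreover have "\<eta>\<^sup>2 = p / (T * n)" using s p n T by simp
      ultimately show "(p / (T * \<eta>))\<^sup>2 = n * p / T"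
        using n0 T by (simp add: power_divide power_mult_distrib) (simp add: power2_eq_square field_simps)
      show "0 \<le> p / (T * \<eta>)" using p T pos by simp
    qed
    then show ?thesis using l_nonneg by simp
  qed
qed

theorem mainTheorem7:
  shows "\<exists>C::real. 0 < C \<and> C \<le> 10 ^ 6 \<and>
    (\<forall>(g :: 'a::euclidean_space \<Rightarrow> real) (h :: 'a \<Rightarrow> real)
      (L\<^sub>h :: real) (\<gamma> :: real) (f\<^sub>\<gamma> :: 'a \<Rightarrow> real) (L\<^sub>\<gamma> :: real) (M :: real) (\<sigma> :: real)
      (P :: 'w measure) (DH :: 's measure) (DG :: 'u measure)
      (dg :: 'a \<Rightarrow> 'u \<Rightarrow> 'a) (dh :: 'a \<Rightarrow> 's \<Rightarrow> 'a)
      (\<xi>h :: nat \<Rightarrow> 'w \<Rightarrow> 's) (\<xi>g :: nat \<Rightarrow> 'w \<Rightarrow> 'u)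
      (x :: nat \<Rightarrow> 'w \<Rightarrow> 'a) (xg :: nat \<Rightarrow> 'w \<Rightarrow> 'a) (m :: nat \<Rightarrow> 'w \<Rightarrow> 'a)
      (T :: nat) (\<alpha> :: real) (\<eta>0 :: real) (\<eta>1 :: real) (\<phi>0 :: real).
      convex_on UNIV g \<longrightarrow> convex_on UNIV h \<longrightarrow>
      0 < L\<^sub>h \<longrightarrow> smooth_fun L\<^sub>h h \<longrightarrow> 0 < \<gamma> \<longrightarrow>
      f\<^sub>\<gamma> = (\<lambda>z. moreau_envelope \<gamma> g z - h z) \<longrightarrow> bdd_below (range f\<^sub>\<gamma>) \<longrightarrow>
      L\<^sub>\<gamma> = L\<^sub>h + 1 / \<gamma> \<longrightarrow>
      unbiased_subgradient_oracle g DG dg M \<longrightarrow>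
      unbiased_gradient_oracle h DH dh \<sigma> \<longrightarrow>
      prob_space P \<longrightarrow> fresh_samples P (x 0) (xg 0) DH \<xi>h DG \<xi>g \<longrightarrow>
      (\<forall>\<omega>\<in>space P. single_loop_momentum \<gamma> \<eta>0 \<eta>1 (\<lambda>t. \<alpha>) dg dh
          (\<lambda>t. \<xi>g t \<omega>) (\<lambda>t. \<xi>h t \<omega>) (\<lambda>t. x t \<omega>) (\<lambda>t. xg t \<omega>) (\<lambda>t. m t \<omega>)) \<longrightarrow>
      1 \<le> T \<longrightarrow>
      \<alpha> = 2 * sqrt 2 * L\<^sub>h * \<eta>0 \<longrightarrow> \<eta>1 = sqrt 32 * \<eta>0 \<longrightarrow>
      \<eta>0 = capped_stepsize (1 / L\<^sub>\<gamma>) (1 / L\<^sub>h) \<phi>0 (real T * (L\<^sub>h * \<sigma>\<^sup>2 + M\<^sup>2 / \<gamma>)) \<longrightarrow>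
      \<phi>0 = (\<integral>\<omega>. f\<^sub>\<gamma> (x 0 \<omega>) - (INF z. f\<^sub>\<gamma> z) \<partial>P)
         + 2 * \<eta>0 / (\<gamma> * \<eta>1) * (\<integral>\<omega>. (norm (xg 1 \<omega> - prox \<gamma> g (x 0 \<omega>)))\<^sup>2 \<partial>P)
         + \<eta>0 / \<alpha> * (\<integral>\<omega>. (norm (m 0 \<omega> - grad h (x 0 \<omega>)))\<^sup>2 \<partial>P) \<longrightarrow>
      integrable P (\<lambda>\<omega>. f\<^sub>\<gamma> (x 0 \<omega>) - (INF z. f\<^sub>\<gamma> z)) \<longrightarrow>
      integrable P (\<lambda>\<omega>. (norm (xg 1 \<omega> - prox \<gamma> g (x 0 \<omega>)))\<^sup>2) \<longrightarrow>
      integrable P (\<lambda>\<omega>. (norm (m 0 \<omega> - grad h (x 0 \<omega>)))\<^sup>2) \<longrightarrow>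
      (\<forall>t<T. integrable P (\<lambda>\<omega>. (norm (grad f\<^sub>\<gamma> (x t \<omega>)))\<^sup>2)) \<longrightarrow>
      1 / real T * (\<Sum>t<T. \<integral>\<omega>. (norm (grad f\<^sub>\<gamma> (x t \<omega>)))\<^sup>2 \<partial>P)
        \<le> C * (sqrt ((L\<^sub>h * \<sigma>\<^sup>2 + M\<^sup>2 / \<gamma>) * \<phi>0 / real T) + L\<^sub>\<gamma> * \<phi>0 / real T))"
\<comment> \<open>The value 128 = 4 * 32 arises when \<eta>1 > \<gamma>; the contracting case gives
  50.\<close>
proof (intro exI[of _ 128] conjI allI impI)
  fix g h :: "'a \<Rightarrow> real" and Lh \<gamma> L\<gamma> M \<sigma> :: real and f\<gamma> :: "'a \<Rightarrow> real"
    and P :: "'w measure" and DH :: "'s measure" and DG :: "'u measure"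
    and dg :: "'a \<Rightarrow> 'u \<Rightarrow> 'a" and dh :: "'a \<Rightarrow> 's \<Rightarrow> 'a"
    and \<xi>h :: "nat \<Rightarrow> 'w \<Rightarrow> 's" and \<xi>g :: "nat \<Rightarrow> 'w \<Rightarrow> 'u"
    and x xg m :: "nat \<Rightarrow> 'w \<Rightarrow> 'a" and T :: nat and \<alpha> \<eta>0 \<eta>1 \<phi>0 :: real
  assume cvx: "convex_on UNIV g" "convex_on UNIV h" and Lh: "0 < Lh" "smooth_fun Lh h"
    and \<gamma>: "0 < \<gamma>" and f\<gamma>: "f\<gamma> = (\<lambda>z. moreau_envelope \<gamma> g z - h z)" and bdd: "bdd_below (range f\<gamma>)"
    and L\<gamma>: "L\<gamma> = Lh + 1 / \<gamma>"
    and dg: "unbiased_subgradient_oracle g DG dg M" and dh: "unbiased_gradient_oracle h DH dh \<sigma>"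
    and P: "prob_space P" and fresh: "fresh_samples P (x 0) (xg 0) DH \<xi>h DG \<xi>g"
    and run: "\<forall>\<omega>\<in>space P. single_loop_momentum \<gamma> \<eta>0 \<eta>1 (\<lambda>t. \<alpha>) dg dh
          (\<lambda>t. \<xi>g t \<omega>) (\<lambda>t. \<xi>h t \<omega>) (\<lambda>t. x t \<omega>) (\<lambda>t. xg t \<omega>) (\<lambda>t. m t \<omega>)"
    and T: "1 \<le> T" and \<alpha>: "\<alpha> = 2 * sqrt 2 * Lh * \<eta>0" and \<eta>1: "\<eta>1 = sqrt 32 * \<eta>0"
    and \<eta>0: "\<eta>0 = capped_stepsize (1 / L\<gamma>) (1 / Lh) \<phi>0 (real T * (Lh * \<sigma>\<^sup>2 + M\<^sup>2 / \<gamma>))"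
    and \<phi>0: "\<phi>0 = (\<integral>\<omega>. f\<gamma> (x 0 \<omega>) - (INF z. f\<gamma> z) \<partial>P)
         + 2 * \<eta>0 / (\<gamma> * \<eta>1) * (\<integral>\<omega>. (norm (xg 1 \<omega> - prox \<gamma> g (x 0 \<omega>)))\<^sup>2 \<partial>P)
         + \<eta>0 / \<alpha> * (\<integral>\<omega>. (norm (m 0 \<omega> - grad h (x 0 \<omega>)))\<^sup>2 \<partial>P)"
    and int: "integrable P (\<lambda>\<omega>. f\<gamma> (x 0 \<omega>) - (INF z. f\<gamma> z))"
      "integrable P (\<lambda>\<omega>. (norm (xg 1 \<omega> - prox \<gamma> g (x 0 \<omega>)))\<^sup>2)"
      "integrable P (\<lambda>\<omega>. (norm (m 0 \<omega> - grad h (x 0 \<omega>)))\<^sup>2)"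
      "\<forall>t<T. integrable P (\<lambda>\<omega>. (norm (grad f\<gamma> (x t \<omega>)))\<^sup>2)"
  interpret P: prob_space P by fact
  interpret moreau_dc g "\<bar>M\<bar>" \<gamma> h Lh
    by unfold_locales
       (use cvx Lh \<gamma> bdd dg in \<open>auto simp: f\<gamma> intro: unbiased_subgradient_oracle_lipschitz\<close>)
  have f_eq: "f\<gamma> = f" unfolding f\<gamma> f_def[abs_def] ..
  let ?n = "Lh * \<sigma>\<^sup>2 + M\<^sup>2 / \<gamma>"
  let ?G = "\<Sum>t<T. \<integral>\<omega>. (norm (grad f\<gamma> (x t \<omega>)))\<^sup>2 \<partial>P"
  \<comment> \<open>Positivity of the step size is inherited from the momentum weight of a
    trajectory; the capped formula by itself could return 0.\<close>
  obtain \<omega> where "\<omega> \<in> space P" using P.not_empty by blast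
  then have "0 < \<alpha>" using run unfolding single_loop_momentum_def by blast
  then have "0 < 2 * sqrt 2 * Lh * \<eta>0" unfolding \<alpha> .
  then have \<eta>0_pos: "0 < \<eta>0" by (rule zero_less_mult_pos) (use Lh in simp)
  then have \<eta>1_pos: "0 < \<eta>1" by (simp add: \<eta>1)
  have T_pos: "0 < real T" using T by simp
  have n: "0 \<le> ?n" using Lh \<gamma> by simp
  \<comment> \<open>\<open>e2\<close> carries the Lyapunov weight, half of that in the potential, so
    the initial Lyapunov value is at most \<open>\<phi>0\<close>.\<close>
  define e1 e2 e3 where "e1 = (\<integral>\<omega>. f\<gamma> (x 0 \<omega>) - (INF z. f\<gamma> z) \<partial>P)"
    and "e2 = \<eta>0 / (\<gamma> * \<eta>1) * (\<integral>\<omega>. (norm (xg 1 \<omega> - prox \<gamma> g (x 0 \<omega>)))\<^sup>2 \<partial>P)"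
    and "e3 = \<eta>0 / \<alpha> * (\<integral>\<omega>. (norm (m 0 \<omega> - grad h (x 0 \<omega>)))\<^sup>2 \<partial>P)"
  have e: "0 \<le> e1" "0 \<le> e2" "0 \<le> e3"
    unfolding e1_def e2_def e3_def f_eq f_inf_def[symmetric]
    using \<eta>0_pos \<eta>1_pos \<open>0 < \<alpha>\<close> \<gamma> f_inf_le
    by (auto intro!: mult_nonneg_nonneg Bochner_Integration.integral_nonneg)
  have \<phi>0_e: "\<phi>0 = e1 + 2 * e2 + e3" unfolding \<phi>0 e1_def e2_def e3_def by simp
  then have \<phi>0_nonneg: "0 \<le> \<phi>0" using e by simp
  have "Lh \<le> L\<gamma>" using \<gamma> by (simp add: L\<gamma>)
  note step = stepsize_bound[OF \<eta>0 \<eta>0_pos Lh(1) this \<phi>0_nonneg n T_pos]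
  have R: "0 \<le> sqrt (?n * \<phi>0 / real T)" "0 \<le> L\<gamma> * \<phi>0 / real T"
    using n \<phi>0_nonneg \<gamma> Lh by (auto simp: L\<gamma>)
  show "1 / real T * ?G \<le> 128 * (sqrt (?n * \<phi>0 / real T) + L\<gamma> * \<phi>0 / real T)"
  proof (cases "\<eta>1 \<le> \<gamma>")
    case True
    interpret R: momentum_run g "\<bar>M\<bar>" \<gamma> h Lh P \<sigma> \<eta>0 \<eta>1 \<alpha> DH DG dg dh \<xi>h \<xi>g x xg m
      by unfold_locales
         (use dg dh fresh run \<alpha> \<eta>1 True in \<open>auto simp: unbiased_subgradient_oracle_def\<close>)
    have "R.integrable_state 0"
      using int unfolding R.integrable_state_def R.gap_def R.prox_err_def R.mom_err_def f_inf_def f_eq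
      by simp
    from R.sum_expectation_grad_sq_le[OF this, of T]
    have "\<eta>0 / 2 * ?G \<le> R.lyapunov 0 + 24 * (real T * ?n * \<eta>0\<^sup>2)"
      unfolding R.grad_sq_def f_eq by (simp add: mult_ac)
    moreover have "R.lyapunov 0 = e1 + e2 + e3"
      unfolding R.lyapunov_def R.gap_def R.prox_err_def R.mom_err_def f_inf_def f_eq e1_def e2_def e3_def
      by simp
    \<comment> \<open>One \<open>\<phi>0\<close> bounds the initial Lyapunov value and 24 more bound
      the accumulated noise.\<close>
    ultimately have "\<eta>0 / 2 * ?G \<le> 25 * \<phi>0" using step(1) e \<phi>0_e by linarith
    then have "1 / real T * ?G \<le> 50 * (\<phi>0 / (real T * \<eta>0))"
      using \<eta>0_pos T_pos by (simp add: field_simps)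
    also have "\<dots> \<le> 50 * (sqrt (?n * \<phi>0 / real T) + L\<gamma> * \<phi>0 / real T)"
      using step(2) by simp
    also have "\<dots> \<le> 128 * (sqrt (?n * \<phi>0 / real T) + L\<gamma> * \<phi>0 / real T)"
      using R by (intro mult_right_mono) auto
    finally show ?thesis .
  next
    case False
    have "?G \<le> (\<Sum>t<T. 4 * M\<^sup>2)"
    proof (rule sum_mono)
      fix t assume "t \<in> {..<T}"
      have "(norm (grad f\<gamma> z))\<^sup>2 \<le> 4 * M\<^sup>2" for z
        using power_mono[OF norm_grad_f_le[of z] norm_ge_zero, of 2] by (simp add: f_eq power_mult_distrib)
      then have "(\<integral>\<omega>. (norm (grad f\<gamma> (x t \<omega>)))\<^sup>2 \<partial>P) \<le> (\<integral>\<omega>. 4 * M\<^sup>2 \<partial>P)"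
        using int(4) \<open>t \<in> {..<T}\<close> by (intro integral_mono) auto
      then show "(\<integral>\<omega>. (norm (grad f\<gamma> (x t \<omega>)))\<^sup>2 \<partial>P) \<le> 4 * M\<^sup>2" by (simp add: P.prob_space)
    qed
    then have "1 / real T * ?G \<le> 4 * M\<^sup>2" using T_pos by (simp add: field_simps)
    also have "\<dots> \<le> 128 * (1 / \<gamma> * \<phi>0 / real T)"
    proof -
      \<comment> \<open>A large \<eta>1 forces \<gamma>^2 \<le> 32 \<eta>0^2. With the noise bound T
        M^2 \<eta>0^2 / \<gamma> \<le> \<open>\<phi>0\<close> this gives T M^2 \<gamma> \<le> 32
        \<open>\<phi>0\<close>, so the uniform bound 4 M^2 is already of order 1 / T.\<close>
      have "\<gamma>\<^sup>2 \<le> \<eta>1\<^sup>2" using False \<gamma> by (intro power_mono) auto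
      then have "\<gamma>\<^sup>2 \<le> 32 * \<eta>0\<^sup>2" by (simp add: \<eta>1 power_mult_distrib)
      then have "real T * (M\<^sup>2 / \<gamma>) * \<gamma>\<^sup>2 \<le> real T * (M\<^sup>2 / \<gamma>) * (32 * \<eta>0\<^sup>2)"
        using \<gamma> by (intro mult_left_mono) auto
      also have "\<dots> \<le> real T * ?n * (32 * \<eta>0\<^sup>2)"
        using Lh by (intro mult_right_mono mult_left_mono) auto
      also have "\<dots> \<le> 32 * \<phi>0" using step(1) by simp
      finally have "real T * M\<^sup>2 * \<gamma> \<le> 32 * \<phi>0"
        using \<gamma> by (simp add: power2_eq_square[of \<gamma>])
      then show ?thesis using \<gamma> T_pos by (simp add: field_simps)
    qed
    also have "\<dots> \<le> 128 * (L\<gamma> * \<phi>0 / real T)"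
      using Lh \<phi>0_nonneg T_pos
      by (intro mult_left_mono divide_right_mono mult_right_mono) (auto simp: L\<gamma>)
    also have "\<dots> \<le> 128 * (sqrt (?n * \<phi>0 / real T) + L\<gamma> * \<phi>0 / real T)"
      using R by simp
    finally show ?thesis .
  qed
qed simp_all

end
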